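(* Let $1/2<\mu\le 2$ and $0<\nu<1/2$. Let $g\in C(\mathbb{R})\cap L^\infty(\mathbb{R})$ be a solution of system (3.12) (i.e. $g=T[g]$), and set $G(x)=g(x)+\tfrac12(\mu-\nu)\ln(x^2+1)$. Assume that $G$ is even and increasing on $[0,\infty)$. Then there exist $x_0>0$ and a constant $c(\mu,\nu)$ depending only on $\mu,\nu$ such that $$\Big\|G(x)-\tfrac12(\mu-\nu)\ln(x^2+x_0^2)\Big\|_{L^\infty(\mathbb{R})}\le c(\mu,\nu).$$
   Context: Let $\theta:\mathbb{R}\to\mathbb{R}$ be the continuous branch of $\arg(x-i)$ with values in $(-\pi,0)$: $\theta(x)=\arctan(-1/x)$ for $x>0$, $\theta(0)=-\pi/2$, $\theta(x)=\arctan(-1/x)-\pi$ for $x<0$; so $\theta(+\infty)=0$, $\theta(-\infty)=-\pi$. For real $g\in C(\mathbb{R})\cap L^\infty(\mathbb{R})$ define: $h^{-1}:\mathbb{R}\to\mathbb{R}$ by $h^{-1}(0)=0$ and $(h^{-1})'(x)=|x|^{\nu-1}(x^2+1)^{(\mu-\nu)/2}e^{g(x)}$ for $x\neq0$; $\kappa>0$ the constant with $\int_{\mathbb{R}}\frac{\kappa}{x\,h^{-1}(x)(h^{-1})'(x)}\,dx=(\mu-\nu)\pi$; $F$ the continuous function with $F'(x)=\frac{\kappa}{x\,h^{-1}(x)(h^{-1})'(x)}$ for $x\ne0$ and $F(+\infty)=0$ (hence $F(-\infty)=-(\mu-\nu)\pi$); and $T[g]=H\big(F-(\mu-\nu)\theta\big)$,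 where $H$ is the Hilbert transform $Hf(x)=\frac1\pi\,\mathrm{p.v.}\int_{\mathbb{R}}\frac{f(y)}{x-y}\,dy$ (principal value at $y=x$ and at infinity). "$g$ solves system (3.12)" means $g=T[g]$. *)

theory Defs
  imports "HOL-Analysis.Analysis"
begin

text \<open>Continuous branch of arg(x - i) with values in (-pi, 0).\<close>
definition theta :: "real \<Rightarrow> real" where
  "theta x = (if x > 0 then arctan (-1/x) else if x = 0 then -pi/2 else arctan (-1/x) - pi)"

definition hinv_deriv :: "real \<Rightarrow> real \<Rightarrow> (real \<Rightarrow> real) \<Rightarrow> real \<Rightarrow> real" where
  "hinv_deriv \<mu> \<nu> g x = \<bar>x\<bar> powr (\<nu> - 1) * (x\<^sup>2 + 1) powr ((\<mu> - \<nu>) / 2) * exp (g x)"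

definition hinv :: "real \<Rightarrow> real \<Rightarrow> (real \<Rightarrow> real) \<Rightarrow> real \<Rightarrow> real" where
  "hinv \<mu> \<nu> g x = (LBINT t=0..x. hinv_deriv \<mu> \<nu> g t)"

definition Fdens :: "real \<Rightarrow> real \<Rightarrow> (real \<Rightarrow> real) \<Rightarrow> real \<Rightarrow> real" where
  "Fdens \<mu> \<nu> g x = 1 / (x * hinv \<mu> \<nu> g x * hinv_deriv \<mu> \<nu> g x)"

definition kappa :: "real \<Rightarrow> real \<Rightarrow> (real \<Rightarrow> real) \<Rightarrow> real" where
  "kappa \<mu> \<nu> g = (\<mu> - \<nu>) * pi / (LBINT t. Fdens \<mu> \<nu> g t)"

text \<open>F(x) = - integral_x^infinity F', so that F(+infinity) = 0.\<close>
definition Ffun :: "real \<Rightarrow> real \<Rightarrow> (real \<Rightarrow> real) \<Rightarrow> real \<Rightarrow> real" where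
  "Ffun \<mu> \<nu> g x = - (LBINT t:{x<..}. kappa \<mu> \<nu> g * Fdens \<mu> \<nu> g t)"

text \<open>Principal value of (1/pi) p.v. int f(y)/(x-y) dy (at y = x and at infinity) equals L.\<close>
definition hilbert_pv :: "(real \<Rightarrow> real) \<Rightarrow> real \<Rightarrow> real \<Rightarrow> bool" where
  "hilbert_pv f x L \<longleftrightarrow>
     ((\<lambda>p. (1/pi) * (LBINT y:{y. fst p < \<bar>x - y\<bar> \<and> \<bar>x - y\<bar> < snd p}. f y / (x - y)))
        \<longlongrightarrow> L) (at_right 0 \<times>\<^sub>F at_top)"

definition solves_312 :: "real \<Rightarrow> real \<Rightarrow> (real \<Rightarrow> real) \<Rightarrow> bool" where
  "solves_312 \<mu> \<nu> g \<longleftrightarrow>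
     (\<forall>x. hilbert_pv (\<lambda>y. Ffun \<mu> \<nu> g y - (\<mu> - \<nu>) * theta y) x (g x))"

end

theory Submission
  imports Defs
begin

text \<open>
  Write \<open>\<beta> = \<mu> - \<nu>\<close> and \<open>\<phi> = F'\<close>. Writing \<open>F\<close> as a tail integral of \<open>\<phi>\<close> and exchanging
  integrals in the truncated Hilbert transform turns \<open>g = T[g]\<close> into
  \<open>G(x) = 1/\<pi> \<integral> ln |x - t| \<phi>(t) dt + O(\<beta>)\<close>. Since \<open>G\<close> is even and increasing,
  \<open>t\<^bsup>2\<nu>\<^esup> \<phi>(t)\<close> decreases on the positive axis, so \<open>t \<phi>(t)\<close> is bounded by a constant depending only on
  \<open>\<mu>, \<nu>\<close>. Hence replacing \<open>ln |x - t|\<close> by \<open>max (ln x) (ln |t|)\<close> costs only a bounded error: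
  \<open>G(e\<^sup>s) = A(s) + O(1)\<close>, where \<open>A' = m\<close> and \<open>m' = p\<close>, with \<open>m(s)\<close> the mass of \<open>\<phi>/\<pi>\<close> on
  \<open>|t| \<le> e\<^sup>s\<close> and \<open>p(s) = (2/\<pi>) e\<^sup>s \<phi>(e\<^sup>s)\<close>. By the formula for \<open>F'\<close>, \<open>B(s) = 2 A(s) - (1 - 2\<nu>) s\<close>
  satisfies a Liouville equation up to constants: \<open>B'' = 2 p\<close> is comparable to \<open>K e\<^bsup>-B\<^esup>\<close>. As \<open>B'\<close>
  runs from \<open>-(1 - 2\<nu>) < 0\<close> to \<open>2\<mu> - 1 > 0\<close>, an energy estimate forces \<open>p\<close> to decay exponentially
  away from the minimum \<open>s\<^sub>0\<close> of \<open>B\<close>. Therefore \<open>A(s) = \<beta> max s s\<^sub>0 + O(1)\<close>, and \<open>x\<^sub>0 = exp s\<^sub>0\<close>.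
\<close>

section \<open>Decay of approximate solutions of the Liouville equation\<close>

lemma liouville_comparison_decay:
  fixes m p A :: "real \<Rightarrow> real"
  assumes m: "\<And>s. (m has_real_derivative p s) (at s)"
    and A: "\<And>s. (A has_real_derivative m s) (at s)"
    and bot: "(m \<longlongrightarrow> 0) at_bot" and top: "(m \<longlongrightarrow> b) at_top"
    and lower: "\<And>s. c1 * K * exp (a * s - 2 * A s) \<le> p s"
    and upper: "\<And>s. p s \<le> c2 * K * exp (a * s - 2 * A s)"
    and bound: "\<And>s. p s \<le> Q"
    and pos: "0 < c1" "0 < c2" "0 < K" "0 < a" "a < 2 * b"
  defines "d \<equiv> c1 * ((2 * b - a)\<^sup>2 / (4 * c2)) * exp (- (2 * b))"
  shows "\<exists>s0. \<forall>s. p s \<le> c2 * Q / c1 * exp (2 * d) * exp (- (2 * d * \<bar>s - s0\<bar>))"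
proof -
  have p_pos: "0 < p s" for s
    using lower[of s] pos by (smt (verit) exp_gt_zero mult_pos_pos)
  have m_less: "m s < m t" if "s < t" for s t
    using that m p_pos by (meson DERIV_pos_imp_increasing)
  have m_mono: "m s \<le> m t" if "s \<le> t" for s t
    using m_less[of s t] that by (cases "s = t") auto
  have m_ge: "0 \<le> m s" for s
  proof (rule tendsto_upperbound[OF bot])
    show "\<forall>\<^sub>F t in at_bot. m t \<le> m s"
      using eventually_le_at_bot[of s] by eventually_elim (rule m_mono)
  qed simp
  have m_le: "m s \<le> b" for s
  proof (rule tendsto_lowerbound[OF top])
    show "\<forall>\<^sub>F t in at_top. m s \<le> m t"
      using eventually_ge_at_top[of s] by eventually_elim (rule m_mono)
  qed simp
  \<comment> \<open>At height \<open>a / 2\<close> the slope of \<open>B\<close> vanishes, so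
    \<open>s0\<close> is the minimum of \<open>B\<close>; the limits \<open>0\<close> and
    \<open>b\<close> of \<open>m\<close> lie on either side of \<open>a / 2\<close>.\<close>
  obtain s0 where s0: "m s0 = a / 2"
  proof -
    have "\<forall>\<^sub>F t in at_bot. m t < a / 2"
      using bot pos by (intro order_tendstoD) auto
    then obtain u where u: "m u < a / 2"
      using eventually_happens trivial_limit_at_bot_linorder by blast
    have "\<forall>\<^sub>F t in at_top. a / 2 < m t"
      using top pos by (intro order_tendstoD) auto
    then obtain v where v: "a / 2 < m v"
      using eventually_happens trivial_limit_at_top_linorder by blast
    have "u \<le> v"
      using u v m_mono[of v u] by linarith
    moreover have "\<forall>x. u \<le> x \<and> x \<le> v \<longrightarrow> isCont m x"
      using m DERIV_isCont by blast
    ultimately show ?thesis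
      using IVT[of m u "a / 2" v] u v that by auto
  qed
  define B where "B s = 2 * A s - a * s" for s
  have B: "(B has_real_derivative 2 * m s - a) (at s)" for s
    unfolding B_def by (auto intro!: derivative_eq_intros A)
  have lowerB: "c1 * K * exp (- B s) \<le> p s" and upperB: "p s \<le> c2 * K * exp (- B s)" for s
    using lower[of s] upper[of s] by (simp_all add: B_def)
  define P where "P = K * exp (- B s0)"
  have P_pos: "0 < P" using pos by (simp add: P_def)
  have B_shift: "K * exp (- B s) = P * exp (- (B s - B s0))" for s
    by (simp add: P_def flip: exp_add)
  define P0 where "P0 = (2 * b - a)\<^sup>2 / (4 * c2)"
  \<comment> \<open>The energy \<open>B'\<^sup>2 / 2 + 2 c2 K exp (- B)\<close> decreases to the right of the minimum of \<open>B\<close>.\<close>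
  have "(2 * m s - a)\<^sup>2 / 2 \<le> 2 * c2 * P" if "s0 \<le> s" for s
  proof -
    let ?E = "\<lambda>s. (2 * m s - a)\<^sup>2 / 2 + 2 * c2 * K * exp (- B s)"
    have "?E s \<le> ?E s0"
    proof (rule DERIV_nonpos_imp_nonincreasing[OF that])
      fix x assume x: "s0 \<le> x" "x \<le> s"
      have "(?E has_real_derivative 2 * (2 * m x - a) * (p x - c2 * K * exp (- B x))) (at x)"
        by (auto intro!: derivative_eq_intros m B simp: field_simps)
      moreover have "2 * (2 * m x - a) * (p x - c2 * K * exp (- B x)) \<le> 0"
        using m_mono[OF x(1)] s0 upperB[of x] by (intro mult_nonneg_nonpos) auto
      ultimately show "\<exists>y. (?E has_real_derivative y) (at x) \<and> y \<le> 0" by blast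
    qed
    moreover have "0 \<le> 2 * c2 * K * exp (- B s)" using pos by simp
    moreover have "(2 * m s0 - a)\<^sup>2 / 2 = 0" by (simp add: s0)
    ultimately show ?thesis unfolding P_def mult.assoc by linarith
  qed
  \<comment> \<open>As \<open>s\<close> tends to infinity the kinetic term tends to
    \<open>(2 * b - a)\<^sup>2 / 2\<close>, which turns the energy inequality into a lower bound
    \<open>P0\<close> for \<open>P\<close> in terms of \<open>a\<close>, \<open>b\<close> and
    \<open>c2\<close> alone.\<close>
  then have "\<forall>\<^sub>F s in at_top. (2 * m s - a)\<^sup>2 / 2 \<le> 2 * c2 * P"
    by (rule eventually_mono[OF eventually_ge_at_top[of s0]])
  moreover have "((\<lambda>s. (2 * m s - a)\<^sup>2 / 2) \<longlongrightarrow> (2 * b - a)\<^sup>2 / 2) at_top"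
    by (intro tendsto_intros top) simp
  ultimately have "(2 * b - a)\<^sup>2 / 2 \<le> 2 * c2 * P"
    by (intro tendsto_upperbound[of _ _ at_top]) auto
  then have P0_le: "P0 \<le> P"
    using pos by (simp add: P0_def field_simps)
  have P0_nonneg: "0 \<le> P0" using pos by (simp add: P0_def)
  have d: "d = c1 * P0 * exp (- (2 * b))" by (simp add: d_def P0_def)
  have d_pos: "0 < d"
    unfolding d P0_def using pos by simp
  \<comment> \<open>The threshold \<open>2 * b\<close> bounds the modulus of the slope of
    \<open>B\<close>, hence the rise of \<open>B\<close> over a unit distance; this is the origin of
    the factor \<open>exp (- (2 * b))\<close> in \<open>d\<close>.\<close>
  have near: "d \<le> p s" if "B s - B s0 \<le> 2 * b" for s
  proof -
    have "d \<le> c1 * P * exp (- (B s - B s0))"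
      unfolding d using P0_le P0_nonneg that pos P_pos by (intro mult_mono) auto
    also have "\<dots> = c1 * K * exp (- B s)"
      using B_shift[of s] by (simp add: mult.assoc)
    finally show ?thesis using lowerB[of s] by linarith
  qed
  have B_Lip: "\<exists>z. min s t \<le> z \<and> z \<le> max s t \<and> B t - B s = (t - s) * (2 * m z - a)" for s t
  proof (cases s t rule: linorder_cases)
    case less
    then obtain z where "z > s" "z < t" "B t - B s = (t - s) * (2 * m z - a)"
      using MVT2[of s t B "\<lambda>x. 2 * m x - a"] B by blast
    then show ?thesis using less by (intro exI[of _ z]) auto
  next
    case greater
    then obtain z where "z > t" "z < s" "B s - B t = (s - t) * (2 * m z - a)"
      using MVT2[of t s B "\<lambda>x. 2 * m x - a"] B by blast
    then show ?thesis using greater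
      by (intro exI[of _ z]) (auto simp: algebra_simps)
  qed auto
  have B_upper: "B s - B s0 \<le> 2 * b" if "\<bar>s - s0\<bar> \<le> 1" for s
  proof -
    obtain z where z: "B s - B s0 = (s - s0) * (2 * m z - a)" using B_Lip by blast
    have "\<bar>2 * m z - a\<bar> \<le> 2 * b" using m_ge[of z] m_le[of z] pos by linarith
    then have "\<bar>s - s0\<bar> * \<bar>2 * m z - a\<bar> \<le> 1 * (2 * b)" using that by (intro mult_mono) auto
    then have "\<bar>B s - B s0\<bar> \<le> 2 * b" unfolding z abs_mult by simp
    then show ?thesis by linarith
  qed
  \<comment> \<open>Since \<open>p \<ge> d\<close> on the unit intervals next to \<open>s0\<close>,
    \<open>m\<close> has moved away from \<open>a / 2\<close> by at least \<open>d\<close> at their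
    far ends.\<close>
  have right: "m s0 + d \<le> m (s0 + 1)"
  proof -
    obtain z where z: "s0 < z" "z < s0 + 1" "m (s0 + 1) - m s0 = (s0 + 1 - s0) * p z"
      using MVT2[of s0 "s0 + 1" m p] m by auto
    have "d \<le> p z" using z by (intro near B_upper) auto
    then show ?thesis using z(3) by simp
  qed
  have left: "m (s0 - 1) \<le> m s0 - d"
  proof -
    obtain z where z: "s0 - 1 < z" "z < s0" "m s0 - m (s0 - 1) = (s0 - (s0 - 1)) * p z"
      using MVT2[of "s0 - 1" s0 m p] m by auto
    have "d \<le> p z" using z by (intro near B_upper) auto
    then show ?thesis using z(3) by simp
  qed
  have B_min: "B s0 \<le> B s" for s
  proof -
    obtain z where z: "min s0 s \<le> z" "z \<le> max s0 s" "B s - B s0 = (s - s0) * (2 * m z - a)"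
      using B_Lip by blast
    have "0 \<le> (s - s0) * (2 * m z - a)"
      using m_mono[of s0 z] m_mono[of z s0] z(1,2) s0
      by (cases "s0 \<le> s") (auto intro: mult_nonneg_nonneg mult_nonpos_nonpos)
    with z show ?thesis by linarith
  qed
  have B_growth: "2 * d * (\<bar>s - s0\<bar> - 1) \<le> B s - B s0" for s
  proof -
    consider "\<bar>s - s0\<bar> \<le> 1" | "s0 + 1 < s" | "s < s0 - 1" by linarith
    then show ?thesis
    proof cases
      case 1
      then have "2 * d * (\<bar>s - s0\<bar> - 1) \<le> 0" using d_pos by (intro mult_nonneg_nonpos) auto
      then show ?thesis using B_min[of s] by linarith
    next
      case 2
      obtain z where z: "s0 + 1 \<le> z" "B s - B (s0 + 1) = (s - (s0 + 1)) * (2 * m z - a)"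
        using B_Lip[of "s0 + 1" s] 2 by auto
      have "2 * d \<le> 2 * m z - a" using m_mono[OF z(1)] right s0 by linarith
      then have "(s - (s0 + 1)) * (2 * d) \<le> (s - (s0 + 1)) * (2 * m z - a)"
        using 2 by (intro mult_left_mono) auto
      then show ?thesis using z(2) 2 B_min[of "s0 + 1"] by (simp add: algebra_simps)
    next
      case 3
      obtain z where z: "z \<le> s0 - 1" "B s - B (s0 - 1) = (s - (s0 - 1)) * (2 * m z - a)"
        using B_Lip[of "s0 - 1" s] 3 by auto
      have "2 * d \<le> a - 2 * m z" using m_mono[OF z(1)] left s0 by linarith
      then have "((s0 - 1) - s) * (2 * d) \<le> ((s0 - 1) - s) * (a - 2 * m z)"
        using 3 by (intro mult_left_mono) auto
      then show ?thesis using z(2) 3 B_min[of "s0 - 1"] by (simp add: algebra_simps)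
    qed
  qed
  \<comment> \<open>Evaluating the uniform bound \<open>Q\<close> at \<open>s0\<close> caps
    \<open>P\<close> from above, so that the depth of the minimum disappears from the
    prefactor.\<close>
  have "c1 * P \<le> Q"
    using lowerB[of s0] bound[of s0] by (simp add: P_def)
  then have P_le: "P \<le> Q / c1" using pos by (simp add: field_simps)
  have "p s \<le> c2 * Q / c1 * exp (2 * d) * exp (- (2 * d * \<bar>s - s0\<bar>))" for s
  proof -
    have "p s \<le> c2 * (P * exp (- (B s - B s0)))"
      using upperB[of s] B_shift[of s] by (simp add: mult.assoc)
    also have "\<dots> \<le> c2 * (Q / c1 * exp (- (2 * d * (\<bar>s - s0\<bar> - 1))))"
      using pos P_le P_pos B_growth[of s] by (intro mult_left_mono mult_mono) auto
    also have "\<dots> = c2 * Q / c1 * exp (2 * d) * exp (- (2 * d * \<bar>s - s0\<bar>))"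
      by (simp add: algebra_simps flip: exp_add)
    finally show ?thesis .
  qed
  then show ?thesis by blast
qed

section \<open>Logarithmic kernels\<close>

lemma AE_lborel_notin_finite:
  fixes S :: "real set"
  assumes "finite S"
  shows "AE t in lborel. t \<notin> S"
  by (rule AE_not_in) (use assms in \<open>simp add: finite_imp_null_set_lborel\<close>)

lemma set_integral_lborel_singleton:
  fixes a :: real and f :: "real \<Rightarrow> real"
  shows "set_integrable lborel {a} f" "(LBINT t:{a}. f t) = 0"
proof -
  have eq: "indicator {a} t *\<^sub>R f t = indicator {a} t *\<^sub>R f a" for t
    by (simp add: indicator_def)
  show "set_integrable lborel {a} f" "(LBINT t:{a}. f t) = 0"
    unfolding set_integrable_def set_lebesgue_integral_def eq by simp_all
qed

lemma even_integral:
  fixes f :: "real \<Rightarrow> real"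
  assumes even: "\<And>t. f (- t) = f t" and int: "set_integrable lborel {0<..} f"
  shows "integrable lborel f" "(LBINT t. f t) = 2 * (LBINT t:{0<..}. f t)"
proof -
  let ?g = "\<lambda>t. indicator {0<..} t * f t"
  have g: "integrable lborel ?g" using int by (simp add: set_integrable_def)
  have g': "integrable lborel (\<lambda>t. ?g (- t))"
    using lborel_integrable_real_affine[OF g, of "-1" 0] by simp
  have gi: "(LBINT t. ?g (- t)) = (LBINT t. ?g t)"
    using lborel_integral_real_affine[of "-1" ?g 0] by simp
  have ae: "AE t in lborel. ?g t + ?g (- t) = f t"
    using AE_lborel_notin_finite[of "{0}"] by (auto simp: even indicator_def elim!: eventually_mono)
  \<comment> \<open>Rebuilding \<open>f\<close> from its two halves and its value at
    \<open>0\<close> gives measurability of \<open>f\<close> itself, not merely of a function equal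
    to it almost everywhere.\<close>
  have m: "f \<in> borel_measurable lborel"
  proof -
    have "(\<lambda>t. if t = 0 then f 0 else ?g t + ?g (- t)) \<in> borel_measurable lborel"
      using g g' by (intro measurable_If borel_measurable_add) auto
    moreover have "(\<lambda>t. if t = 0 then f 0 else ?g t + ?g (- t)) = f"
      by (auto simp: even indicator_def)
    ultimately show ?thesis by simp
  qed
  have sum: "integrable lborel (\<lambda>t. ?g t + ?g (- t))" using g g' by (rule Bochner_Integration.integrable_add)
  show "integrable lborel f"
    by (rule integrable_cong_AE_imp[OF sum m]) (use ae in \<open>auto elim: eventually_mono\<close>)
  have "(LBINT t. f t) = (LBINT t. ?g t + ?g (- t))"
    by (rule integral_cong_AE) (use m sum ae in \<open>auto elim: eventually_mono\<close>)
  also have "\<dots> = 2 * (LBINT t. ?g t)"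
    using g g' gi by (subst Bochner_Integration.integral_add) auto
  finally show "(LBINT t. f t) = 2 * (LBINT t:{0<..}. f t)"
    by (simp add: set_lebesgue_integral_def)
qed

text \<open>The substitution \<open>u = \<bar>ln (abs t) - s\<bar>\<close> maps each of the four
  pieces cut out by the sign of \<open>t\<close> and by \<open>\<bar>t\<bar> = exp s\<close> onto
  the positive axis, where \<open>k\<close> has integral \<open>L\<close>. It is carried out through
  the antiderivatives \<open>- \<Psi> (s - ln t)\<close> and \<open>\<Psi> (ln t - s)\<close>;
  reflection gives the negative half.\<close>

lemma log_kernel_integral:
  fixes k \<Psi> :: "real \<Rightarrow> real" and s :: real
  assumes deriv: "\<And>u. 0 < u \<Longrightarrow> (\<Psi> has_real_derivative k u) (at u)"
    and cont: "\<And>u. 0 < u \<Longrightarrow> isCont k u" and nonneg: "\<And>u. 0 < u \<Longrightarrow> 0 \<le> k u"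
    and zero: "(\<Psi> \<longlongrightarrow> 0) (at_right 0)" and top: "(\<Psi> \<longlongrightarrow> L) at_top"
  shows "integrable lborel (\<lambda>t. k \<bar>ln (abs t) - s\<bar> / \<bar>t\<bar>)"
    and "(LBINT t. k \<bar>ln (abs t) - s\<bar> / \<bar>t\<bar>) = 4 * L"
proof -
  let ?f = "\<lambda>t. k \<bar>ln (abs t) - s\<bar> / \<bar>t\<bar>"
  let ?x = "exp s"
  have ln_less: "ln t < s" if "0 < t" "t < ?x" for t
    using that by (metis exp_gt_zero ln_exp ln_less_cancel_iff)
  have ln_gt: "s < ln t" if "?x < t" for t
    using that by (metis exp_gt_zero ln_exp ln_less_cancel_iff order_less_trans)
  have 1: "set_integrable lborel (einterval 0 (ereal ?x)) ?f"
          "(LBINT t=0..ereal ?x. ?f t) = 0 - (- L)"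
  proof -
    let ?F = "\<lambda>t. - \<Psi> (s - ln t)"
    have F: "DERIV ?F t :> ?f t" if "0 < ereal t" "ereal t < ereal ?x" for t
    proof -
      have u: "0 < s - ln t" "0 < t" using that ln_less[of t] by auto
      have "((\<lambda>t. s - ln t) has_real_derivative - inverse t) (at t)"
        using u by (auto intro!: derivative_eq_intros simp: inverse_eq_divide)
      from DERIV_minus[OF DERIV_chain2[OF deriv[OF u(1)] this]] u show ?thesis
        by (simp add: field_simps)
    qed
    have c: "isCont ?f t" if "0 < ereal t" "ereal t < ereal ?x" for t
    proof -
      have u: "0 < \<bar>ln (abs t) - s\<bar>" "t \<noteq> 0" using that ln_less[of t] by auto
      have "isCont (\<lambda>t. \<bar>ln (abs t) - s\<bar>) t" using u by (intro continuous_intros) auto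
      from isCont_o2[OF this cont[OF u(1)]] show ?thesis
        using u by (intro isCont_divide continuous_rabs continuous_ident) auto
    qed
    have n: "AE t in lborel. 0 < ereal t \<longrightarrow> ereal t < ereal ?x \<longrightarrow> 0 \<le> ?f t"
      using ln_less by (intro AE_I2) (auto intro!: divide_nonneg_nonneg nonneg)
    have "((\<lambda>t. - \<Psi> (s - ln t)) \<longlongrightarrow> - L) (at_right 0)"
    proof (intro tendsto_minus filterlim_compose[OF top])
      have "filterlim (\<lambda>t::real. - ln t) at_top (at_right 0)"
        using ln_at_0 filterlim_uminus_at_top[of "\<lambda>t. - ln t"] by simp
      then show "filterlim (\<lambda>t::real. s - ln t) at_top (at_right 0)"
        using filterlim_tendsto_add_at_top[OF tendsto_const, of "\<lambda>t. - ln t" _ s] by simp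
    qed
    then have a: "((?F \<circ> real_of_ereal) \<longlongrightarrow> - L) (at_right 0)"
      by (simp add: zero_ereal_def ereal_tendsto_simps)
    have "((\<lambda>t. - \<Psi> (s - ln t)) \<longlongrightarrow> - 0) (at_left ?x)"
    proof (intro tendsto_minus filterlim_compose[OF zero])
      have "((\<lambda>t. s - ln t) \<longlongrightarrow> s - ln ?x) (at_left ?x)"
        by (intro tendsto_intros) auto
      moreover have "\<forall>\<^sub>F t in at_left ?x. 0 < s - ln t"
        using eventually_at_left_real[of 0 ?x] ln_less by (auto elim!: eventually_mono)
      ultimately show "filterlim (\<lambda>t. s - ln t) (at_right 0) (at_left ?x)"
        by (auto simp: filterlim_at elim: eventually_mono)
    qed
    then have b: "((?F \<circ> real_of_ereal) \<longlongrightarrow> 0) (at_left (ereal ?x))"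
      by (simp add: ereal_tendsto_simps)
    show "set_integrable lborel (einterval 0 (ereal ?x)) ?f"
         "(LBINT t=0..ereal ?x. ?f t) = 0 - (- L)"
      using interval_integral_FTC_nonneg[OF _ F c n a b] by (auto)
  qed
  have 2: "set_integrable lborel (einterval (ereal ?x) \<infinity>) ?f"
          "(LBINT t=ereal ?x..\<infinity>. ?f t) = L - 0"
  proof -
    let ?F = "\<lambda>t. \<Psi> (ln t - s)"
    have xp: "0 < t" if "?x < t" for t using that by (meson exp_gt_zero order_less_trans)
    have F: "DERIV ?F t :> ?f t" if "ereal ?x < ereal t" "ereal t < \<infinity>" for t
    proof -
      have u: "0 < ln t - s" "0 < t" using that ln_gt[of t] xp[of t] by auto
      have "((\<lambda>t. ln t - s) has_real_derivative inverse t) (at t)"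
        using u by (auto intro!: derivative_eq_intros simp: inverse_eq_divide)
      from DERIV_chain2[OF deriv[OF u(1)] this] u show ?thesis
        by (simp add: field_simps)
    qed
    have c: "isCont ?f t" if "ereal ?x < ereal t" "ereal t < \<infinity>" for t
    proof -
      have u: "0 < \<bar>ln (abs t) - s\<bar>" "t \<noteq> 0" using that ln_gt[of t] xp[of t] by auto
      have "isCont (\<lambda>t. \<bar>ln (abs t) - s\<bar>) t" using u by (intro continuous_intros) auto
      from isCont_o2[OF this cont[OF u(1)]] show ?thesis
        using u by (intro isCont_divide continuous_rabs continuous_ident) auto
    qed
    have n: "AE t in lborel. ereal ?x < ereal t \<longrightarrow> ereal t < \<infinity> \<longrightarrow> 0 \<le> ?f t"
      using ln_gt xp by (intro AE_I2) (fastforce intro!: divide_nonneg_nonneg nonneg)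
    have "((\<lambda>t. \<Psi> (ln t - s)) \<longlongrightarrow> L) at_top"
    proof (intro filterlim_compose[OF top])
      show "filterlim (\<lambda>t::real. ln t - s) at_top at_top"
        using filterlim_tendsto_add_at_top[OF tendsto_const ln_at_top, of "-s"] by simp
    qed
    then have b: "((?F \<circ> real_of_ereal) \<longlongrightarrow> L) (at_left \<infinity>)"
      by (simp add: ereal_tendsto_simps)
    have "((\<lambda>t. \<Psi> (ln t - s)) \<longlongrightarrow> 0) (at_right ?x)"
    proof (intro filterlim_compose[OF zero])
      have "((\<lambda>t. ln t - s) \<longlongrightarrow> ln ?x - s) (at_right ?x)"
        by (intro tendsto_intros) auto
      moreover have "\<forall>\<^sub>F t in at_right ?x. 0 < ln t - s"
        using eventually_at_right_less[of ?x] ln_gt by (auto elim!: eventually_mono)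
      ultimately show "filterlim (\<lambda>t. ln t - s) (at_right 0) (at_right ?x)"
        by (auto simp: filterlim_at elim: eventually_mono)
    qed
    then have a: "((?F \<circ> real_of_ereal) \<longlongrightarrow> 0) (at_right (ereal ?x))"
      by (simp add: ereal_tendsto_simps)
    show "set_integrable lborel (einterval (ereal ?x) \<infinity>) ?f"
         "(LBINT t=ereal ?x..\<infinity>. ?f t) = L - 0"
      using interval_integral_FTC_nonneg[OF _ F c n a b] by auto
  qed
  have e1: "einterval 0 (ereal ?x) = {0<..<?x}" by (auto simp: einterval_def)
  have e2: "einterval (ereal ?x) \<infinity> = {?x<..}" by (auto simp: einterval_def)
  have i1: "set_integrable lborel {0<..<?x} ?f" and i2: "set_integrable lborel {?x<..} ?f"
    using 1(1) 2(1) by (simp_all add: e1 e2)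
  have v1: "(LBINT t:{0<..<?x}. ?f t) = L" and v2: "(LBINT t:{?x<..}. ?f t) = L"
    using 1(2) 2(2) by (simp_all add: interval_lebesgue_integral_def e1 e2)
  note i0 = set_integral_lborel_singleton(1)[of ?x ?f] and v0 = set_integral_lborel_singleton(2)[of ?x ?f]
  have i3: "set_integrable lborel ({0<..<?x} \<union> {?x}) ?f"
    using i1 i0 by (rule set_integrable_Un) auto
  have v3: "(LBINT t:({0<..<?x} \<union> {?x}). ?f t) = L"
    using i1 i0 v1 v0 by (subst set_integral_Un) auto
  have eq: "{0<..} = ({0<..<?x} \<union> {?x}) \<union> {?x<..}"
    by (auto intro: order_less_trans[of 0 ?x])
  have i: "set_integrable lborel {0<..} ?f"
    unfolding eq using i3 i2 by (rule set_integrable_Un) auto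
  have v: "(LBINT t:{0<..}. ?f t) = 2 * L"
    unfolding eq using i3 i2 v3 v2 by (subst set_integral_Un) auto
  show "integrable lborel ?f" by (rule even_integral(1)[OF _ i]) simp
  show "(LBINT t. ?f t) = 4 * L" using even_integral(2)[OF _ i] v by simp
qed

lemma exp_log_kernel_integral:
  fixes \<delta> s :: real
  assumes "0 < \<delta>"
  shows "integrable lborel (\<lambda>t. exp (- (\<delta> * \<bar>ln (abs t) - s\<bar>)) / \<bar>t\<bar>)"
    and "(LBINT t. exp (- (\<delta> * \<bar>ln (abs t) - s\<bar>)) / \<bar>t\<bar>) = 4 / \<delta>"
proof -
  have d: "((\<lambda>u. (1 - exp (- (\<delta> * u))) / \<delta>) has_real_derivative exp (- (\<delta> * u))) (at u)" for u
    using assms by (auto intro!: derivative_eq_intros)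
  have z: "((\<lambda>u. (1 - exp (- (\<delta> * u))) / \<delta>) \<longlongrightarrow> 0) (at_right 0)"
    using assms by (auto intro!: tendsto_eq_intros)
  have "filterlim (\<lambda>u. \<delta> * u) at_top at_top"
    using assms by (simp add: filterlim_tendsto_pos_mult_at_top[OF tendsto_const _ filterlim_ident])
  then have "((\<lambda>u. exp (- (\<delta> * u))) \<longlongrightarrow> 0) at_top"
    by (intro filterlim_compose[OF exp_at_bot]) (simp add: filterlim_uminus_at_bot)
  then have "((\<lambda>u. (1 - exp (- (\<delta> * u))) / \<delta>) \<longlongrightarrow> (1 - 0) / \<delta>) at_top"
    using assms by (intro tendsto_intros) auto
  then have t: "((\<lambda>u. (1 - exp (- (\<delta> * u))) / \<delta>) \<longlongrightarrow> 1 / \<delta>) at_top" by simp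
  note * = log_kernel_integral[where k = "\<lambda>u. exp (- (\<delta> * u))", OF d _ _ z t, of s]
  show "integrable lborel (\<lambda>t. exp (- (\<delta> * \<bar>ln (abs t) - s\<bar>)) / \<bar>t\<bar>)"
    by (rule *(1)) auto
  show "(LBINT t. exp (- (\<delta> * \<bar>ln (abs t) - s\<bar>)) / \<bar>t\<bar>) = 4 / \<delta>"
    by (subst *(2)) auto
qed

text \<open>The majorant comes from \<open>- ln (1 - w) \<le> 2 w / sqrt (1 - w)\<close> with \<open>w = exp (- u)\<close>.\<close>

definition log_defect :: "real \<Rightarrow> real" where
  "log_defect u = 2 * exp (- u) / sqrt (1 - exp (- u))"

lemma log_defect_nonneg: "0 \<le> u \<Longrightarrow> 0 \<le> log_defect u"
  by (simp add: log_defect_def)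

text \<open>The antiderivative \<open>4 * sqrt (1 - exp (- u))\<close> rises from 0 to 4, so the
  singularity at \<open>u = 0\<close> is integrable; the four pieces contribute 4 each.\<close>

lemma log_defect_integral:
  fixes s :: real
  shows "integrable lborel (\<lambda>t. log_defect \<bar>ln (abs t) - s\<bar> / \<bar>t\<bar>)"
    and "(LBINT t. log_defect \<bar>ln (abs t) - s\<bar> / \<bar>t\<bar>) = 16"
proof -
  let ?\<Psi> = "\<lambda>u::real. 4 * sqrt (1 - exp (- u))"
  have d: "(?\<Psi> has_real_derivative log_defect u) (at u)" if "0 < u" for u
    using that by (auto intro!: derivative_eq_intros simp: log_defect_def field_simps)
  have z: "(?\<Psi> \<longlongrightarrow> 0) (at_right 0)"
    by (auto intro!: tendsto_eq_intros)
  have "((\<lambda>u::real. exp (- u)) \<longlongrightarrow> 0) at_top"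
    by (intro filterlim_compose[OF exp_at_bot] filterlim_uminus_at_bot_at_top)
  then have "(?\<Psi> \<longlongrightarrow> 4 * sqrt (1 - 0)) at_top"
    by (intro tendsto_intros)
  then have t: "(?\<Psi> \<longlongrightarrow> 4) at_top" by simp
  have c: "isCont log_defect u" if "0 < u" for u
    unfolding log_defect_def[abs_def] using that by (intro continuous_intros) auto
  have n: "0 \<le> log_defect u" if "0 < u" for u
    using that log_defect_nonneg by simp
  note * = log_kernel_integral[OF d c n z t]
  show "integrable lborel (\<lambda>t. log_defect \<bar>ln (abs t) - s\<bar> / \<bar>t\<bar>)" by (rule *(1))
  show "(LBINT t. log_defect \<bar>ln (abs t) - s\<bar> / \<bar>t\<bar>) = 16" by (subst *(2)) auto
qed

text \<open>If \<open>y\<close> is the larger of \<open>x\<close> and \<open>\<bar>t\<bar>\<close>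
  and \<open>w\<close> the ratio of the smaller to the larger, then \<open>\<bar>x - t\<bar>\<close>
  is \<open>y * (1 - w)\<close> or \<open>y * (1 + w)\<close>, so the error is
  \<open>ln (1 - w)\<close> or \<open>ln (1 + w)\<close>.\<close>

lemma ln_dist_approx_max:
  fixes x t :: real
  assumes "0 < x" "t \<noteq> 0" "\<bar>t\<bar> \<noteq> x"
  shows "\<bar>ln (abs (x - t)) - max (ln x) (ln (abs t))\<bar> \<le> log_defect \<bar>ln (abs t) - ln x\<bar>"
proof -
  define w where "w = exp (- \<bar>ln (abs t) - ln x\<bar>)"
  define y where "y = max x \<bar>t\<bar>"
  have "ln (abs t) \<noteq> ln x" using assms by simp
  then have w: "0 < w" "w < 1" by (auto simp: w_def)
  have y: "0 < y" using assms by (auto simp: y_def)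
  have lny: "max (ln x) (ln (abs t)) = ln y"
    using assms by (auto simp: y_def max_def)
  have w_eq: "w * y = min x \<bar>t\<bar>"
  proof (cases "x < \<bar>t\<bar>")
    case True
    then have "w = exp (ln x - ln (abs t))" using assms by (simp add: w_def)
    then show ?thesis using True assms by (simp add: exp_diff y_def)
  next
    case False
    then have "\<bar>t\<bar> < x" using assms by simp
    then have "w = exp (ln (abs t) - ln x)" using assms by (simp add: w_def)
    then show ?thesis using False assms by (simp add: exp_diff y_def)
  qed
  have sq: "0 < sqrt (1 - w)" "sqrt (1 - w) \<le> 1" "(sqrt (1 - w))\<^sup>2 = 1 - w" using w by auto
  have "\<bar>x - t\<bar> = y * (1 - w) \<or> \<bar>x - t\<bar> = y * (1 + w)"
  proof (cases "0 < t")
    case True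
    then have "\<bar>x - t\<bar> = y - min x \<bar>t\<bar>" using assms by (auto simp: y_def)
    then show ?thesis using w_eq by (simp add: algebra_simps)
  next
    case False
    then have "\<bar>x - t\<bar> = y + min x \<bar>t\<bar>" using assms by (auto simp: y_def)
    then show ?thesis using w_eq by (simp add: algebra_simps)
  qed
  then have "\<bar>ln (abs (x - t)) - ln y\<bar> \<le> 2 * w / sqrt (1 - w)"
  proof
    assume "\<bar>x - t\<bar> = y * (1 - w)"
    then have "ln (abs (x - t)) - ln y = ln (1 - w)" using y w by (simp add: ln_mult)
    \<comment> \<open>Taking the square root before applying \<open>ln z \<le> z - 1\<close> leaves
      the singularity \<open>1 / sqrt (1 - w)\<close>, which is integrable at \<open>w = 1\<close>,
      in place of \<open>1 / (1 - w)\<close>, which is not.\<close>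
    also have "\<dots> = - (2 * ln (inverse (sqrt (1 - w))))"
      using w sq by (simp add: ln_sqrt ln_inverse)
    finally have eq: "ln (abs (x - t)) - ln y = - (2 * ln (inverse (sqrt (1 - w))))" .
    have "1 \<le> inverse (sqrt (1 - w))" using sq by (simp add: one_le_inverse)
    then have "0 \<le> ln (inverse (sqrt (1 - w)))" by simp
    moreover have "ln (inverse (sqrt (1 - w))) \<le> inverse (sqrt (1 - w)) - 1"
      using sq by (intro ln_le_minus_one) simp
    moreover have "inverse (sqrt (1 - w)) - 1 \<le> w / sqrt (1 - w)"
    proof -
      have "1 - w \<le> sqrt (1 - w)"
        using sq mult_left_le[of "sqrt (1 - w)" "sqrt (1 - w)"] by (simp add: power2_eq_square)
      then have "(1 - sqrt (1 - w)) / sqrt (1 - w) \<le> w / sqrt (1 - w)"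
        using sq by (intro divide_right_mono) auto
      then show ?thesis using sq by (simp add: diff_divide_distrib inverse_eq_divide)
    qed
    ultimately show ?thesis unfolding eq by simp
  next
    assume "\<bar>x - t\<bar> = y * (1 + w)"
    then have eq: "ln (abs (x - t)) - ln y = ln (1 + w)" using y w by (simp add: ln_mult)
    have "0 \<le> ln (1 + w)" "ln (1 + w) \<le> w" using w by (auto simp: ln_add_one_self_le_self)
    moreover have "w * sqrt (1 - w) \<le> w * 2" using w sq by (intro mult_left_mono) linarith+
    then have "w \<le> 2 * w / sqrt (1 - w)" using sq by (simp add: field_simps)
    ultimately show ?thesis unfolding eq by simp
  qed
  then show ?thesis unfolding lny log_defect_def w_def .
qed

section \<open>Hilbert transforms as logarithmic potentials\<close>

lemma integral_inverse_diff:
  fixes x c d :: real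
  assumes "c \<le> d" "x \<notin> {c..d}"
  shows "(LBINT y:{c<..<d}. 1 / (x - y)) = ln (abs (x - c)) - ln (abs (x - d))"
proof -
  \<comment> \<open>The square makes one antiderivative serve on both sides of
    \<open>x\<close>.\<close>
  let ?F = "\<lambda>y. - (ln ((x - y)\<^sup>2) / 2)"
  have F: "?F y = - ln (abs (x - y))" if "y \<noteq> x" for y
    using that ln_realpow[of "\<bar>x - y\<bar>" 2] by simp
  have "(LBINT y=c..d. 1 / (x - y)) = ?F d - ?F c"
  proof (rule interval_integral_FTC_finite)
    show "continuous_on {min c d..max c d} (\<lambda>y. 1 / (x - y))"
      using assms by (intro continuous_intros) auto
    fix y assume "min c d \<le> y" "y \<le> max c d"
    with assms have "y \<noteq> x" by auto
    then have "(?F has_real_derivative 1 / (x - y)) (at y)"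
    proof -
      have "0 < (x - y)\<^sup>2" "x - y \<noteq> 0" using \<open>y \<noteq> x\<close> by auto
      then have "(?F has_real_derivative - (1 / (x - y)\<^sup>2 * (2 * (x - y) * (0 - 1)) / 2)) (at y)"
        by (auto intro!: derivative_eq_intros simp: divide_simps)
      moreover have "- (1 / z\<^sup>2 * (2 * z * (0 - 1)) / 2) = 1 / z" if "z \<noteq> 0" for z :: real
        using that by (simp add: power2_eq_square)
      ultimately show ?thesis using \<open>x - y \<noteq> 0\<close> by metis
    qed
    then show "(?F has_vector_derivative 1 / (x - y)) (at y within {min c d..max c d})"
      using has_field_derivative_at_within has_real_derivative_iff_has_vector_derivative by blast
  qed
  then show ?thesis
    using assms F[of c] F[of d] by (auto simp: interval_lebesgue_integral_def einterval_eq)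
qed

text \<open>Truncating the kernel \<open>1 / (x - y)\<close> to
  \<open>\<epsilon> < \<bar>x - y\<bar> < R\<close> and integrating in \<open>y\<close> cuts off the
  argument of the logarithm in exactly this way.\<close>

definition clamp_dist :: "real \<Rightarrow> real \<Rightarrow> real \<Rightarrow> real" where
  "clamp_dist \<epsilon> R r = min R (max \<epsilon> r)"

text \<open>For \<open>\<epsilon> \<le> 1 \<le> R\<close> clamping can only move \<open>r\<close>
  towards 1. This gives a majorant common to all truncations when the cutoffs are removed by
  dominated convergence.\<close>

lemma abs_ln_clamp_dist_le:
  assumes "\<epsilon> \<le> 1" "1 \<le> R" "0 < \<epsilon>" "0 < r"
  shows "\<bar>ln (clamp_dist \<epsilon> R r)\<bar> \<le> \<bar>ln r\<bar>"
proof (cases "r \<le> 1")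
  case True
  then have "r \<le> clamp_dist \<epsilon> R r" "clamp_dist \<epsilon> R r \<le> 1"
    using assms by (auto simp: clamp_dist_def)
  then have "ln r \<le> ln (clamp_dist \<epsilon> R r)" "ln (clamp_dist \<epsilon> R r) \<le> 0"
    using assms by auto
  then show ?thesis by linarith
next
  case False
  then have "clamp_dist \<epsilon> R r \<le> r" "1 \<le> clamp_dist \<epsilon> R r"
    using assms by (auto simp: clamp_dist_def)
  then have "ln (clamp_dist \<epsilon> R r) \<le> ln r" "0 \<le> ln (clamp_dist \<epsilon> R r)"
    by auto
  then show ?thesis by linarith
qed

lemma truncated_kernel_integral:
  fixes x t \<epsilon> R :: real
  assumes "0 < \<epsilon>" "\<epsilon> < R"
  shows "(LBINT y. indicator {y. \<epsilon> < \<bar>x - y\<bar> \<and> \<bar>x - y\<bar> < R} y * indicator {y<..} t / (x - y))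
    = ln R - ln (clamp_dist \<epsilon> R \<bar>x - t\<bar>)"
proof -
  \<comment> \<open>The part of the truncated region below \<open>t\<close> consists of one interval
    on each side of \<open>x\<close>. \<open>b\<close> and \<open>b'\<close> are their right ends,
    chosen so that an interval not reached by \<open>t\<close> becomes empty.\<close>
  define b where "b = max (x - R) (min t (x - \<epsilon>))"
  define b' where "b' = max (x + \<epsilon>) (min t (x + R))"
  have eq: "indicator {y. \<epsilon> < \<bar>x - y\<bar> \<and> \<bar>x - y\<bar> < R} y * indicator {y<..} t / (x - y)
      = indicator ({x - R<..<b} \<union> {x + \<epsilon><..<b'}) y *\<^sub>R (1 / (x - y))" for y :: real
  proof -
    have "\<epsilon> < \<bar>x - y\<bar> \<and> \<bar>x - y\<bar> < R \<and> y < t \<longleftrightarrow> y \<in> {x - R<..<b} \<union> {x + \<epsilon><..<b'}"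
      unfolding Un_iff greaterThanLessThan_iff b_def b'_def using assms by linarith
    then show ?thesis by (auto simp: indicator_def)
  qed
  have 1: "x - R \<le> b" "x \<notin> {x - R..b}" and 2: "x + \<epsilon> \<le> b'" "x \<notin> {x + \<epsilon>..b'}"
    using assms by (auto simp: b_def b'_def)
  have int: "set_integrable lborel {c<..<d} (\<lambda>y. 1 / (x - y))" if "x \<notin> {c..d}" for c d
    by (rule set_integrable_subset[of _ "{c..d}"])
       (use that in \<open>auto intro!: borel_integrable_atLeastAtMost' continuous_intros\<close>)
  have "(LBINT y:({x - R<..<b} \<union> {x + \<epsilon><..<b'}). 1 / (x - y))
      = (LBINT y:{x - R<..<b}. 1 / (x - y)) + (LBINT y:{x + \<epsilon><..<b'}. 1 / (x - y))"
    using 1 2 assms by (intro set_integral_Un int) (auto simp: b_def)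
  also have "\<dots> = ln R - ln (abs (x - b)) + (ln \<epsilon> - ln (abs (x - b')))"
    using assms by (simp add: integral_inverse_diff[OF 1] integral_inverse_diff[OF 2])
  also have "\<dots> = ln R - ln (clamp_dist \<epsilon> R \<bar>x - t\<bar>)"
  proof (cases "t \<le> x")
    case True
    then have "b' = x + \<epsilon>" "abs (x - b) = clamp_dist \<epsilon> R \<bar>x - t\<bar>"
      using assms by (auto simp: b_def b'_def clamp_dist_def)
    then show ?thesis using assms by simp
  next
    case False
    then have "b = x - \<epsilon>" "abs (x - b') = clamp_dist \<epsilon> R \<bar>x - t\<bar>"
      using assms by (auto simp: b_def b'_def clamp_dist_def)
    then show ?thesis using assms by simp
  qed
  finally show ?thesis unfolding eq set_lebesgue_integral_def .
qed

text \<open>By Fubini, \<open>\<phi> t\<close> is multiplied by the integral of the truncated kernel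
  over \<open>y < t\<close>, which is
  \<open>ln R - ln (clamp_dist \<epsilon> R \<bar>x - t\<bar>)\<close>. The vanishing total mass
  removes \<open>ln R\<close>. Fubini applies because the truncated kernel is at most
  \<open>1 / \<epsilon>\<close> on a set of finite measure.\<close>

lemma truncated_hilbert_eq:
  fixes \<phi> :: "real \<Rightarrow> real" and x \<epsilon> R :: real
  assumes \<phi>: "integrable lborel \<phi>" and zero: "(LBINT t. \<phi> t) = 0" and \<epsilon>: "0 < \<epsilon>" "\<epsilon> < R"
  shows "(LBINT y:{y. \<epsilon> < \<bar>x - y\<bar> \<and> \<bar>x - y\<bar> < R}. - (LBINT t:{y<..}. \<phi> t) / (x - y))
    = (LBINT t. \<phi> t * ln (clamp_dist \<epsilon> R \<bar>x - t\<bar>))"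
proof -
  let ?S = "{y. \<epsilon> < \<bar>x - y\<bar> \<and> \<bar>x - y\<bar> < R}"
  let ?k = "\<lambda>t y::real. indicator ?S y * indicator {y<..} t / (x - y) :: real"
  have [measurable]: "\<phi> \<in> borel_measurable borel" using \<phi> by auto
  have ind: "indicator {y<..} t = (if y < t then 1 else 0 :: real)" for y t :: real
    by (auto simp: indicator_def)
  have S_eq: "?S = {x - R<..<x - \<epsilon>} \<union> {x + \<epsilon><..<x + R}"
    using \<epsilon> by auto
  have S_fin: "emeasure lborel ?S < \<infinity>"
  proof -
    have "emeasure lborel ?S \<le> emeasure lborel {x - R..x + R}"
      using \<epsilon> by (intro emeasure_mono) auto
    also have "\<dots> < \<infinity>" using \<epsilon> by simp
    finally show ?thesis .
  qed
  have S_meas: "?S \<in> sets lborel" by (simp add: S_eq)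
  have S_int: "integrable lborel (indicator ?S :: real \<Rightarrow> real)"
    using S_fin S_meas by (intro integrable_real_indicator) auto
  have k_bound: "norm (?k t y) \<le> indicator ?S y / \<epsilon>" for t y
    using \<epsilon> by (auto simp: indicator_def frac_le)
  have meas: "(\<lambda>(t, y). \<phi> t * ?k t y) \<in> borel_measurable (lborel \<Otimes>\<^sub>M lborel)"
    unfolding ind S_eq by measurable
  have k_meas: "(\<lambda>y. ?k t y) \<in> borel_measurable lborel" for t
    unfolding ind S_eq by measurable
  have k_int: "integrable lborel (?k t)" for t
  proof (rule Bochner_Integration.integrable_bound[OF _ k_meas])
    show "integrable lborel (\<lambda>y. indicator ?S y / \<epsilon> :: real)" using S_int by simp
    show "AE y in lborel. norm (?k t y) \<le> norm (indicator ?S y / \<epsilon> :: real)"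
      using k_bound by (intro AE_I2) (smt (verit) real_norm_def)
  qed
  have int: "integrable (lborel \<Otimes>\<^sub>M lborel) (\<lambda>(t, y). \<phi> t * ?k t y)"
  proof (rule lborel_pair.Fubini_integrable[OF meas])
    show "AE t in lborel. integrable lborel (\<lambda>y. case (t, y) of (t, y) \<Rightarrow> \<phi> t * ?k t y)"
      unfolding prod.case by (intro AE_I2 integrable_mult_right k_int)
    let ?C = "LBINT y. indicator ?S y / \<epsilon>"
    have n: "(LBINT y. norm (case (t, y) of (t, y) \<Rightarrow> \<phi> t * ?k t y)) = \<bar>\<phi> t\<bar> * (LBINT y. norm (?k t y))" for t
      unfolding prod.case real_norm_def abs_mult[of "\<phi> t"] by (rule integral_mult_right_zero)
    have le: "(LBINT y. norm (?k t y)) \<le> ?C" for t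
      using S_int by (intro integral_mono integrable_norm k_int k_bound) simp
    have ge: "0 \<le> (LBINT y. norm (?k t y))" for t by (rule Bochner_Integration.integral_nonneg) simp
    show "integrable lborel (\<lambda>t. LBINT y. norm (case (t, y) of (t, y) \<Rightarrow> \<phi> t * ?k t y))"
    proof (rule Bochner_Integration.integrable_bound[of _ "\<lambda>t. \<phi> t * ?C"])
      show "(\<lambda>t. LBINT y. norm (case (t, y) of (t, y) \<Rightarrow> \<phi> t * ?k t y)) \<in> borel_measurable lborel"
        using meas by measurable
      show "AE t in lborel. norm (LBINT y. norm (case (t, y) of (t, y) \<Rightarrow> \<phi> t * ?k t y)) \<le> norm (\<phi> t * ?C)"
      proof (rule AE_I2)
        fix t
        have "\<bar>LBINT y. norm (?k t y)\<bar> \<le> \<bar>?C\<bar>" using le[of t] ge[of t] by linarith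
        then show "norm (LBINT y. norm (case (t, y) of (t, y) \<Rightarrow> \<phi> t * ?k t y)) \<le> norm (\<phi> t * ?C)"
          unfolding n by (simp only: real_norm_def abs_mult[of "\<phi> t"] abs_mult[of "\<bar>\<phi> t\<bar>"] abs_idempotent)
            (intro mult_left_mono; simp)
      qed
    qed (use \<phi> in auto)
  qed
  have "(LBINT y:?S. - (LBINT t:{y<..}. \<phi> t) / (x - y)) = - (LBINT y. LBINT t. \<phi> t * ?k t y)"
  proof -
    have inner: "indicator ?S y *\<^sub>R (- (LBINT t:{y<..}. \<phi> t) / (x - y)) = - (LBINT t. \<phi> t * ?k t y)" for y
    proof -
      have "(LBINT t. \<phi> t * ?k t y) = (LBINT t. (indicator {y<..} t * \<phi> t) * (indicator ?S y / (x - y)))"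
        by (intro Bochner_Integration.integral_cong) auto
      also have "\<dots> = (LBINT t:{y<..}. \<phi> t) * (indicator ?S y / (x - y))"
        by (simp add: set_lebesgue_integral_def)
      finally have eq: "(LBINT t. \<phi> t * ?k t y) = (LBINT t:{y<..}. \<phi> t) * (indicator ?S y / (x - y))" .
      show ?thesis unfolding eq by simp
    qed
    show ?thesis
      unfolding set_lebesgue_integral_def[of lborel ?S] inner by (rule integral_minus)
  qed
  also have "(LBINT y. LBINT t. \<phi> t * ?k t y) = (LBINT t. LBINT y. \<phi> t * ?k t y)"
    by (rule lborel_pair.Fubini_integral[OF int])
  also have "\<dots> = (LBINT t. \<phi> t * (ln R - ln (clamp_dist \<epsilon> R \<bar>x - t\<bar>)))"
    unfolding integral_mult_right_zero truncated_kernel_integral[OF \<epsilon>] ..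
  also have "\<dots> = (LBINT t. \<phi> t * ln R) - (LBINT t. \<phi> t * ln (clamp_dist \<epsilon> R \<bar>x - t\<bar>))"
  proof (subst Bochner_Integration.integral_diff[symmetric])
    have "ln \<epsilon> \<le> ln (clamp_dist \<epsilon> R r)" "ln (clamp_dist \<epsilon> R r) \<le> ln R" for r
      using \<epsilon> by (auto simp: clamp_dist_def)
    then have b: "\<bar>ln (clamp_dist \<epsilon> R r)\<bar> \<le> \<bar>ln \<epsilon>\<bar> + \<bar>ln R\<bar>" for r
      by (smt (verit))
    show "integrable lborel (\<lambda>t. \<phi> t * ln (clamp_dist \<epsilon> R \<bar>x - t\<bar>))"
    proof (rule Bochner_Integration.integrable_bound[of _ "\<lambda>t. \<phi> t * (\<bar>ln \<epsilon>\<bar> + \<bar>ln R\<bar>)"])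
      show "(\<lambda>t. \<phi> t * ln (clamp_dist \<epsilon> R \<bar>x - t\<bar>)) \<in> borel_measurable lborel"
        unfolding clamp_dist_def by measurable
      show "AE t in lborel. norm (\<phi> t * ln (clamp_dist \<epsilon> R \<bar>x - t\<bar>)) \<le> norm (\<phi> t * (\<bar>ln \<epsilon>\<bar> + \<bar>ln R\<bar>))"
        using b by (intro AE_I2) (auto simp: abs_mult intro!: mult_left_mono)
    qed (use \<phi> in auto)
  qed (use \<phi> in \<open>auto simp: right_diff_distrib\<close>)
  finally show ?thesis using zero by simp
qed

lemma hilbert_pv_log_potential:
  fixes \<phi> :: "real \<Rightarrow> real" and x L :: real
  assumes \<phi>: "integrable lborel \<phi>" and zero: "(LBINT t. \<phi> t) = 0"
    and log: "integrable lborel (\<lambda>t. \<phi> t * ln (abs (x - t)))"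
    and hil: "hilbert_pv (\<lambda>y. - (LBINT t:{y<..}. \<phi> t)) x L"
  shows "L = 1 / pi * (LBINT t. \<phi> t * ln (abs (x - t)))"
proof -
  \<comment> \<open>The joint limit in \<open>hilbert_pv\<close> may be followed along a single
    sequence. The shift by 2 secures \<open>\<epsilon> < R\<close> already at \<open>n = 0\<close>,
    where a shift by 1 would give equality.\<close>
  let ?\<epsilon> = "\<lambda>n::nat. 1 / (real n + 2)" and ?R = "\<lambda>n::nat. real n + 2"
  have [measurable]: "\<phi> \<in> borel_measurable borel" using \<phi> by auto
  have R: "filterlim ?R at_top sequentially"
    using filterlim_tendsto_add_at_top[OF tendsto_const filterlim_real_sequentially, of 2]
    by (simp add: add.commute)
  have "((\<lambda>n. inverse (?R n)) \<longlongrightarrow> 0) sequentially"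
    using tendsto_inverse_0_at_top[OF R] .
  then have e: "filterlim ?\<epsilon> (at_right 0) sequentially"
    by (auto simp: filterlim_at inverse_eq_divide)
  have "((\<lambda>n. (1/pi) * (LBINT y:{y. ?\<epsilon> n < \<bar>x - y\<bar> \<and> \<bar>x - y\<bar> < ?R n}. - (LBINT t:{y<..}. \<phi> t) / (x - y)))
      \<longlongrightarrow> L) sequentially"
    using filterlim_compose[OF hil[unfolded hilbert_pv_def] filterlim_Pair[OF e R]] by simp
  moreover have "?\<epsilon> n < ?R n" for n
  proof -
    have "?\<epsilon> n \<le> 1" by simp
    also have "1 < ?R n" by simp
    finally show ?thesis .
  qed
  ultimately have lim: "(\<lambda>n. (1/pi) * (LBINT t. \<phi> t * ln (clamp_dist (?\<epsilon> n) (?R n) \<bar>x - t\<bar>))) \<longlonglongrightarrow> L"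
    by (subst (asm) truncated_hilbert_eq[OF \<phi> zero]) auto
  have "(\<lambda>n. LBINT t. \<phi> t * ln (clamp_dist (?\<epsilon> n) (?R n) \<bar>x - t\<bar>))
      \<longlonglongrightarrow> (LBINT t. \<phi> t * ln (abs (x - t)))"
  proof (rule integral_dominated_convergence[where w = "\<lambda>t. norm (\<phi> t * ln (abs (x - t)))"])
    have ae: "AE t in lborel. t \<noteq> x"
      by (rule AE_lborel_singleton)
    show "AE t in lborel. (\<lambda>n. \<phi> t * ln (clamp_dist (?\<epsilon> n) (?R n) \<bar>x - t\<bar>)) \<longlonglongrightarrow> \<phi> t * ln (abs (x - t))"
      using ae
    proof eventually_elim
      fix t assume "t \<noteq> x"
      then have pos: "0 < \<bar>x - t\<bar>" by simp
      have "\<forall>\<^sub>F n in sequentially. ?\<epsilon> n < \<bar>x - t\<bar>"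
        using e pos unfolding filterlim_at by (metis order_tendstoD(2))
      moreover have "\<forall>\<^sub>F n in sequentially. \<bar>x - t\<bar> \<le> ?R n"
        using R by (auto simp: filterlim_at_top)
      ultimately have "\<forall>\<^sub>F n in sequentially. \<phi> t * ln (clamp_dist (?\<epsilon> n) (?R n) \<bar>x - t\<bar>) = \<phi> t * ln (abs (x - t))"
        by eventually_elim (simp add: clamp_dist_def)
      then show "(\<lambda>n. \<phi> t * ln (clamp_dist (?\<epsilon> n) (?R n) \<bar>x - t\<bar>)) \<longlonglongrightarrow> \<phi> t * ln (abs (x - t))"
        by (rule tendsto_eventually)
    qed
    show "AE t in lborel. norm (\<phi> t * ln (clamp_dist (?\<epsilon> n) (?R n) \<bar>x - t\<bar>)) \<le> norm (\<phi> t * ln (abs (x - t)))" for n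
      using ae
    proof eventually_elim
      fix t assume "t \<noteq> x"
      then have pos: "0 < \<bar>x - t\<bar>" by simp
      have "?\<epsilon> n \<le> 1" "1 \<le> ?R n" "0 < ?\<epsilon> n" by simp_all
      then have "\<bar>ln (clamp_dist (?\<epsilon> n) (?R n) \<bar>x - t\<bar>)\<bar> \<le> \<bar>ln (abs (x - t))\<bar>"
        using pos by (intro abs_ln_clamp_dist_le)
      then show "norm (\<phi> t * ln (clamp_dist (?\<epsilon> n) (?R n) \<bar>x - t\<bar>)) \<le> norm (\<phi> t * ln (abs (x - t)))"
        by (simp add: abs_mult mult_left_mono)
    qed
    show "integrable lborel (\<lambda>t. norm (\<phi> t * ln (abs (x - t))))" using log by auto
    show "(\<lambda>t. \<phi> t * ln (clamp_dist (?\<epsilon> n) (?R n) \<bar>x - t\<bar>)) \<in> borel_measurable lborel" for n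
      unfolding clamp_dist_def by measurable
  qed (use log in auto)
  then have "(\<lambda>n. (1/pi) * (LBINT t. \<phi> t * ln (clamp_dist (?\<epsilon> n) (?R n) \<bar>x - t\<bar>)))
      \<longlonglongrightarrow> 1 / pi * (LBINT t. \<phi> t * ln (abs (x - t)))"
    by (intro tendsto_mult_left)
  with lim show ?thesis by (rule LIMSEQ_unique)
qed

section \<open>Logarithmic potentials of densities\<close>

text \<open>The hypothesis is exponential decay in the variable \<open>ln (abs t)\<close> around
  \<open>s0\<close>. Half of the rate absorbs the linear weight, by
  \<open>u \<le> 2 / \<delta> * exp (\<delta> / 2 * u)\<close>; the other half is integrated. The
  bound on the spread around \<open>s0\<close> does not depend on \<open>s0\<close>.\<close>

lemma log_decay_integrable:
  fixes \<phi> :: "real \<Rightarrow> real"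
  assumes meas: "\<phi> \<in> borel_measurable borel" and \<delta>: "0 < \<delta>"
    and bound: "\<And>t. t \<noteq> 0 \<Longrightarrow> \<bar>\<phi> t\<bar> * \<bar>t\<bar> \<le> C * exp (- (\<delta> * \<bar>ln (abs t) - s0\<bar>))"
  shows "integrable lborel \<phi>"
    and "integrable lborel (\<lambda>t. \<phi> t * (ln (abs t) - s0))"
    and "(LBINT t. \<bar>\<phi> t * (ln (abs t) - s0)\<bar>) \<le> 16 * C / \<delta>\<^sup>2"
proof -
  have [measurable]: "\<phi> \<in> borel_measurable borel" by (rule meas)
  have ae: "AE t in lborel. t \<noteq> (0 :: real)" by (rule AE_lborel_singleton)
  have C: "0 \<le> C"
    using bound[of 1] by (smt (verit) exp_gt_zero zero_le_mult_iff abs_ge_zero)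
  show "integrable lborel \<phi>"
  proof (rule Bochner_Integration.integrable_bound)
    show "integrable lborel (\<lambda>t. C * (exp (- (\<delta> * \<bar>ln (abs t) - s0\<bar>)) / \<bar>t\<bar>))"
      by (intro integrable_mult_right exp_log_kernel_integral \<delta>)
    show "AE t in lborel. norm (\<phi> t) \<le> norm (C * (exp (- (\<delta> * \<bar>ln (abs t) - s0\<bar>)) / \<bar>t\<bar>))"
      using ae
    proof eventually_elim
      fix t :: real assume "t \<noteq> 0"
      with bound[OF this] C show "norm (\<phi> t) \<le> norm (C * (exp (- (\<delta> * \<bar>ln (abs t) - s0\<bar>)) / \<bar>t\<bar>))"
        by (simp add: abs_mult field_simps)
    qed
  qed simp
  let ?k = "\<lambda>t. 2 * C / \<delta> * (exp (- (\<delta> / 2 * \<bar>ln (abs t) - s0\<bar>)) / \<bar>t\<bar>)"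
  have k: "integrable lborel ?k"
    using \<delta> by (intro integrable_mult_right exp_log_kernel_integral) simp
  have le: "AE t in lborel. \<bar>\<phi> t * (ln (abs t) - s0)\<bar> \<le> ?k t"
    using ae
  proof eventually_elim
    fix t :: real assume t: "t \<noteq> 0"
    define u where "u = \<bar>ln (abs t) - s0\<bar>"
    have "\<delta> / 2 * u \<le> exp (\<delta> / 2 * u)"
      using exp_ge_add_one_self[of "\<delta> / 2 * u"] by linarith
    then have "u \<le> 2 / \<delta> * exp (\<delta> / 2 * u)" using \<delta> by (simp add: field_simps)
    then have "\<bar>\<phi> t\<bar> * \<bar>t\<bar> * u \<le> C * exp (- (\<delta> * u)) * (2 / \<delta> * exp (\<delta> / 2 * u))"
      using bound[OF t] C unfolding u_def by (intro mult_mono[of "_ * _"]) auto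
    also have "\<dots> = 2 * C / \<delta> * exp (- (\<delta> / 2 * u))"
      by (simp flip: exp_add)
    finally have "\<bar>\<phi> t * (ln (abs t) - s0)\<bar> * \<bar>t\<bar> \<le> 2 * C / \<delta> * exp (- (\<delta> / 2 * u))"
      by (simp add: abs_mult u_def mult_ac)
    then have "\<bar>\<phi> t * (ln (abs t) - s0)\<bar> \<le> 2 * C / \<delta> * exp (- (\<delta> / 2 * u)) / \<bar>t\<bar>"
      using t by (subst pos_le_divide_eq) auto
    then show "\<bar>\<phi> t * (ln (abs t) - s0)\<bar> \<le> ?k t" unfolding u_def by simp
  qed
  show int: "integrable lborel (\<lambda>t. \<phi> t * (ln (abs t) - s0))"
  proof (rule Bochner_Integration.integrable_bound[OF k])
    show "AE t in lborel. norm (\<phi> t * (ln (abs t) - s0)) \<le> norm (?k t)"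
      using le by eventually_elim (unfold real_norm_def, linarith)
  qed simp
  have "(LBINT t. \<bar>\<phi> t * (ln (abs t) - s0)\<bar>) \<le> (LBINT t. ?k t)"
    using int k le by (intro integral_mono_AE) auto
  also have "\<dots> = 2 * C / \<delta> * (4 / (\<delta> / 2))"
    using \<delta> by (subst integral_mult_right_zero, subst exp_log_kernel_integral(2)) auto
  also have "\<dots> = 16 * C / \<delta>\<^sup>2" by (simp add: power2_eq_square)
  finally show "(LBINT t. \<bar>\<phi> t * (ln (abs t) - s0)\<bar>) \<le> 16 * C / \<delta>\<^sup>2" .
qed

text \<open>In the variable \<open>s = ln x\<close>, this is the circular mean of the logarithmic
  potential: by Jensen's formula the mean of \<open>ln \<bar>z - t\<bar>\<close> over the circle
  \<open>\<bar>z\<bar> = exp s\<close> in the complex plane is \<open>max s (ln (abs t))\<close> for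
  \<open>t \<noteq> 0\<close>.\<close>

definition max_potential :: "(real \<Rightarrow> real) \<Rightarrow> real \<Rightarrow> real" where
  "max_potential \<phi> s = 1 / pi * (LBINT t. \<phi> t * max s (ln (abs t)))"

definition log_mass :: "(real \<Rightarrow> real) \<Rightarrow> real \<Rightarrow> real" where
  "log_mass \<phi> s = 1 / pi * (LBINT t:{t. \<bar>t\<bar> \<le> exp s}. \<phi> t)"

locale log_density =
  fixes \<phi> :: "real \<Rightarrow> real"
  assumes nonneg: "0 \<le> \<phi> t"
    and int: "integrable lborel \<phi>"
    and int_ln: "integrable lborel (\<lambda>t. \<phi> t * ln (abs t))"
begin

lemma measurable_density[measurable]: "\<phi> \<in> borel_measurable borel"
  using int by auto

lemma max_potential_integrable: "integrable lborel (\<lambda>t. \<phi> t * max s (ln (abs t)))"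
proof (rule Bochner_Integration.integrable_bound)
  show "integrable lborel (\<lambda>t. \<bar>\<phi> t * s\<bar> + \<bar>\<phi> t * ln (abs t)\<bar>)"
    by (intro Bochner_Integration.integrable_add integrable_abs int_ln integrable_mult_left int)
  have "\<bar>max s l\<bar> \<le> \<bar>s\<bar> + \<bar>l\<bar>" for l :: real by linarith
  then have "\<bar>\<phi> t\<bar> * \<bar>max s l\<bar> \<le> \<bar>\<phi> t\<bar> * (\<bar>s\<bar> + \<bar>l\<bar>)" for t l
    by (intro mult_left_mono) auto
  then show "AE t in lborel. norm (\<phi> t * max s (ln (abs t))) \<le> norm (\<bar>\<phi> t * s\<bar> + \<bar>\<phi> t * ln (abs t)\<bar>)"
    by (intro AE_I2) (simp add: abs_mult distrib_left)
qed simp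

text \<open>The error integrand is at most \<open>\<phi> t * \<bar>t\<bar>\<close> times
  \<open>log_defect \<bar>ln (abs t) - ln x\<bar> / \<bar>t\<bar>\<close>. The first factor is at
  most \<open>Q\<close> and the second has integral 16 for every \<open>x\<close>, so the estimate
  is uniform in \<open>x\<close>.\<close>

lemma log_potential_approx:
  assumes Q: "\<And>t. \<phi> t * \<bar>t\<bar> \<le> Q" and x: "0 < x"
  shows "integrable lborel (\<lambda>t. \<phi> t * ln (abs (x - t)))"
    and "\<bar>1 / pi * (LBINT t. \<phi> t * ln (abs (x - t))) - max_potential \<phi> (ln x)\<bar> \<le> 16 * Q / pi"
proof -
  let ?D = "\<lambda>t. \<phi> t * ln (abs (x - t)) - \<phi> t * max (ln x) (ln (abs t))"
  let ?k = "\<lambda>t. Q * (log_defect \<bar>ln (abs t) - ln x\<bar> / \<bar>t\<bar>)"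
  have k: "integrable lborel ?k" by (intro integrable_mult_right log_defect_integral)
  have fin: "finite {0, x, -x}" by simp
  have le: "AE t in lborel. \<bar>?D t\<bar> \<le> ?k t"
    using AE_lborel_notin_finite[of "{0, x, -x}", OF fin]
  proof eventually_elim
    fix t assume "t \<notin> {0, x, -x}"
    then have t: "t \<noteq> 0" "t \<noteq> x" "t \<noteq> - x" by auto
    let ?d = "log_defect \<bar>ln (abs t) - ln x\<bar>"
    have "\<bar>?D t\<bar> = \<phi> t * \<bar>ln (abs (x - t)) - max (ln x) (ln (abs t))\<bar>"
      using nonneg[of t] by (simp add: abs_mult flip: right_diff_distrib)
    also have "\<dots> \<le> \<phi> t * ?d"
      using t x nonneg by (intro mult_left_mono ln_dist_approx_max) auto
    also have "\<dots> = (\<phi> t * \<bar>t\<bar>) * (?d / \<bar>t\<bar>)" using t by simp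
    also have "\<dots> \<le> Q * (?d / \<bar>t\<bar>)"
      by (intro mult_right_mono Q divide_nonneg_nonneg log_defect_nonneg) auto
    finally show "\<bar>?D t\<bar> \<le> ?k t" .
  qed
  have D: "integrable lborel ?D"
  proof (rule Bochner_Integration.integrable_bound[OF k])
    show "AE t in lborel. norm (?D t) \<le> norm (?k t)"
      using le by eventually_elim (unfold real_norm_def, linarith)
  qed simp
  from Bochner_Integration.integrable_add[OF D max_potential_integrable[of "ln x"]]
  show int_x: "integrable lborel (\<lambda>t. \<phi> t * ln (abs (x - t)))" by simp
  have "\<bar>LBINT t. ?D t\<bar> \<le> (LBINT t. \<bar>?D t\<bar>)" by (rule integral_abs_bound)
  also have "\<dots> \<le> (LBINT t. ?k t)" using D k le by (intro integral_mono_AE) auto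
  also have "\<dots> = Q * 16" by (subst integral_mult_right_zero, subst log_defect_integral(2)) simp
  finally have "\<bar>LBINT t. ?D t\<bar> \<le> 16 * Q" by simp
  moreover have "1 / pi * (LBINT t. \<phi> t * ln (abs (x - t))) - max_potential \<phi> (ln x) = 1 / pi * (LBINT t. ?D t)"
    unfolding max_potential_def using int_x max_potential_integrable
    by (subst Bochner_Integration.integral_diff) (auto simp: right_diff_distrib)
  ultimately show "\<bar>1 / pi * (LBINT t. \<phi> t * ln (abs (x - t))) - max_potential \<phi> (ln x)\<bar> \<le> 16 * Q / pi"
    by (simp add: abs_mult divide_right_mono)
qed

text \<open>Since \<open>max s\<close> is 1-Lipschitz, moving all the mass to
  \<open>\<bar>t\<bar> = exp s0\<close> changes the potential by at most the spread of
  \<open>ln (abs t)\<close> around \<open>s0\<close>.\<close>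

lemma max_potential_approx:
  assumes mass: "(LBINT t. \<phi> t) = b * pi"
    and spread: "(LBINT t. \<bar>\<phi> t * (ln (abs t) - s0)\<bar>) \<le> I"
  shows "\<bar>max_potential \<phi> s - b * max s s0\<bar> \<le> I / pi"
proof -
  let ?D = "\<lambda>t. \<phi> t * max s (ln (abs t)) - \<phi> t * max s s0"
  have i: "integrable lborel (\<lambda>t. \<phi> t * max s s0)" using int by simp
  have D: "integrable lborel ?D" using i max_potential_integrable by (rule Bochner_Integration.integrable_diff[rotated])
  have S: "integrable lborel (\<lambda>t. \<phi> t * (ln (abs t) - s0))"
    using int int_ln by (simp add: right_diff_distrib)
  have "\<bar>LBINT t. ?D t\<bar> \<le> (LBINT t. \<bar>?D t\<bar>)" by (rule integral_abs_bound)
  also have "\<dots> \<le> (LBINT t. \<bar>\<phi> t * (ln (abs t) - s0)\<bar>)"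
  proof (rule integral_mono)
    show "\<bar>?D t\<bar> \<le> \<bar>\<phi> t * (ln (abs t) - s0)\<bar>" for t
    proof -
      have "\<bar>?D t\<bar> = \<bar>\<phi> t\<bar> * \<bar>max s (ln (abs t)) - max s s0\<bar>"
        by (simp flip: abs_mult right_diff_distrib)
      also have "\<dots> \<le> \<bar>\<phi> t\<bar> * \<bar>ln (abs t) - s0\<bar>"
        by (intro mult_left_mono) linarith+
      finally show ?thesis by (simp add: abs_mult)
    qed
  qed (use D S in auto)
  finally have "\<bar>LBINT t. ?D t\<bar> \<le> I" using spread by linarith
  moreover have "max_potential \<phi> s - b * max s s0 = 1 / pi * (LBINT t. ?D t)"
    unfolding max_potential_def using i max_potential_integrable mass
    by (subst Bochner_Integration.integral_diff) (auto simp: field_simps)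
  ultimately show ?thesis by (simp add: abs_mult divide_right_mono)
qed

lemma ball_integrable: "integrable lborel (\<lambda>t. indicator {t. \<bar>t\<bar> \<le> r} t * \<phi> t)"
proof (rule Bochner_Integration.integrable_bound[OF int])
  have "{t. \<bar>t\<bar> \<le> r} = {-r..r}" by auto
  then have "{t. \<bar>t\<bar> \<le> r} \<in> sets borel" by simp
  then show "(\<lambda>t. indicator {t. \<bar>t\<bar> \<le> r} t * \<phi> t) \<in> borel_measurable lborel" by measurable
qed (auto simp: indicator_def)

text \<open>For fixed \<open>t\<close> the function \<open>max s (ln (abs t))\<close> has slope 1
  once \<open>s\<close> exceeds \<open>ln (abs t)\<close> and slope 0 before. Hence its increment
  lies between \<open>s' - s\<close> times the indicators of the balls of radius
  \<open>exp s\<close> and \<open>exp s'\<close>.\<close>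

lemma max_potential_increments:
  assumes "s \<le> s'"
  shows "log_mass \<phi> s * (s' - s) \<le> max_potential \<phi> s' - max_potential \<phi> s"
    and "max_potential \<phi> s' - max_potential \<phi> s \<le> log_mass \<phi> s' * (s' - s)"
proof -
  let ?D = "\<lambda>t. \<phi> t * max s' (ln (abs t)) - \<phi> t * max s (ln (abs t))"
  let ?i = "\<lambda>s t. indicator {t. \<bar>t\<bar> \<le> exp s} t * \<phi> t"
  have D: "integrable lborel ?D" by (intro Bochner_Integration.integrable_diff max_potential_integrable)
  have eq: "max_potential \<phi> s' - max_potential \<phi> s = 1 / pi * (LBINT t. ?D t)"
    unfolding max_potential_def using max_potential_integrable
    by (subst Bochner_Integration.integral_diff) (auto simp: right_diff_distrib)
  have m: "log_mass \<phi> r * (s' - s) = 1 / pi * (LBINT t. ?i r t * (s' - s))" for r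
    by (simp add: log_mass_def set_lebesgue_integral_def)
  have ae: "AE t in lborel. t \<noteq> (0 :: real)" by (rule AE_lborel_singleton)
  have l: "\<bar>t\<bar> \<le> exp r \<longleftrightarrow> ln (abs t) \<le> r" if "t \<noteq> 0" for t r :: real
    using that by (metis exp_gt_zero ln_exp ln_le_cancel_iff zero_less_abs_iff)
  have "(LBINT t. ?i s t * (s' - s)) \<le> (LBINT t. ?D t)"
  proof (rule integral_mono_AE[OF integrable_mult_left[OF ball_integrable] D])
    show "AE t in lborel. ?i s t * (s' - s) \<le> ?D t"
      using ae
    proof eventually_elim
      fix t :: real assume t: "t \<noteq> 0"
      have "?i s t * (s' - s) = \<phi> t * (if ln (abs t) \<le> s then s' - s else 0)"
        using l[OF t] by (simp add: indicator_def)
      also have "\<dots> \<le> \<phi> t * (max s' (ln (abs t)) - max s (ln (abs t)))"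
        using assms by (intro mult_left_mono nonneg) auto
      finally show "?i s t * (s' - s) \<le> ?D t" by (simp add: right_diff_distrib)
    qed
  qed
  then show "log_mass \<phi> s * (s' - s) \<le> max_potential \<phi> s' - max_potential \<phi> s"
    unfolding eq m by (intro mult_left_mono) auto
  have "(LBINT t. ?D t) \<le> (LBINT t. ?i s' t * (s' - s))"
  proof (rule integral_mono_AE[OF D integrable_mult_left[OF ball_integrable]])
    show "AE t in lborel. ?D t \<le> ?i s' t * (s' - s)"
      using ae
    proof eventually_elim
      fix t :: real assume t: "t \<noteq> 0"
      have "?D t = \<phi> t * (max s' (ln (abs t)) - max s (ln (abs t)))" by (simp add: right_diff_distrib)
      also have "\<dots> \<le> \<phi> t * (if ln (abs t) \<le> s' then s' - s else 0)"
        using assms by (intro mult_left_mono nonneg) auto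
      also have "\<dots> = ?i s' t * (s' - s)"
        using l[OF t] by (simp add: indicator_def)
      finally show "?D t \<le> ?i s' t * (s' - s)" .
    qed
  qed
  then show "max_potential \<phi> s' - max_potential \<phi> s \<le> log_mass \<phi> s' * (s' - s)"
    unfolding eq m by (intro mult_left_mono) auto
qed

text \<open>The difference quotient lies between the values of \<open>log_mass\<close> at the two
  end points, so continuity of \<open>log_mass\<close> suffices and no differentiation under the
  integral occurs.\<close>

lemma max_potential_deriv:
  assumes cont: "isCont (log_mass \<phi>) s"
  shows "(max_potential \<phi> has_real_derivative log_mass \<phi> s) (at s)"
  unfolding has_field_derivative_iff
proof (rule tendsto_sandwich)
  let ?q = "\<lambda>y. (max_potential \<phi> y - max_potential \<phi> s) / (y - s)"
  have lim: "(log_mass \<phi> \<longlongrightarrow> log_mass \<phi> s) (at s)" using cont by (simp add: isCont_def)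
  show "((\<lambda>y. min (log_mass \<phi> s) (log_mass \<phi> y)) \<longlongrightarrow> log_mass \<phi> s) (at s)"
    using tendsto_min[OF tendsto_const[of "log_mass \<phi> s"] lim] by simp
  show "((\<lambda>y. max (log_mass \<phi> s) (log_mass \<phi> y)) \<longlongrightarrow> log_mass \<phi> s) (at s)"
    using tendsto_max[OF tendsto_const[of "log_mass \<phi> s"] lim] by simp
  have *: "min (log_mass \<phi> s) (log_mass \<phi> y) \<le> ?q y \<and> ?q y \<le> max (log_mass \<phi> s) (log_mass \<phi> y)" if "y \<noteq> s" for y
  proof (cases "s < y")
    case True
    then have "log_mass \<phi> s \<le> ?q y" "?q y \<le> log_mass \<phi> y"
      using max_potential_increments[of s y] by (simp_all add: pos_le_divide_eq pos_divide_le_eq)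
    then show ?thesis by linarith
  next
    case False
    with that have y: "y < s" by simp
    have "?q y = (max_potential \<phi> s - max_potential \<phi> y) / (s - y)"
      by (metis minus_diff_eq minus_divide_divide)
    with y have "log_mass \<phi> y \<le> ?q y" "?q y \<le> log_mass \<phi> s"
      using max_potential_increments[of y s] by (simp_all add: pos_le_divide_eq pos_divide_le_eq)
    then show ?thesis by linarith
  qed
  show "\<forall>\<^sub>F y in at s. min (log_mass \<phi> s) (log_mass \<phi> y) \<le> ?q y"
       "\<forall>\<^sub>F y in at s. ?q y \<le> max (log_mass \<phi> s) (log_mass \<phi> y)"
    using * by (auto simp: eventually_at_filter)
qed

lemma log_mass_at_top:
  assumes "(LBINT t. \<phi> t) = b * pi"
  shows "(log_mass \<phi> \<longlongrightarrow> b) at_top"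
proof -
  have "((\<lambda>s. LBINT t. indicator {t. \<bar>t\<bar> \<le> exp s} t * \<phi> t) \<longlongrightarrow> (LBINT t. \<phi> t)) at_top"
  proof (rule integral_dominated_convergence_at_top[OF _ _ int])
    show "\<forall>\<^sub>F s in at_top. AE t in lborel. norm (indicator {t. \<bar>t\<bar> \<le> exp s} t * \<phi> t) \<le> \<phi> t"
      using nonneg by (auto simp: indicator_def)
    show "AE t in lborel. ((\<lambda>s. indicator {t. \<bar>t\<bar> \<le> exp s} t * \<phi> t) \<longlongrightarrow> \<phi> t) at_top"
    proof (rule AE_I2, rule tendsto_eventually)
      fix t :: real
      have "\<forall>\<^sub>F s in at_top. \<bar>t\<bar> \<le> exp s"
        using exp_at_top unfolding filterlim_at_top by (rule spec)
      then show "\<forall>\<^sub>F s in at_top. indicator {t. \<bar>t\<bar> \<le> exp s} t * \<phi> t = \<phi> t"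
        by eventually_elim simp
    qed
  qed (use ball_integrable in auto)
  then have "((\<lambda>s. 1 / pi * (LBINT t. indicator {t. \<bar>t\<bar> \<le> exp s} t * \<phi> t)) \<longlongrightarrow> 1 / pi * (LBINT t. \<phi> t)) at_top"
    by (rule tendsto_mult_left)
  then show ?thesis
    by (simp add: log_mass_def[abs_def] set_lebesgue_integral_def assms)
qed

lemma log_mass_at_bot: "(log_mass \<phi> \<longlongrightarrow> 0) at_bot"
proof -
  \<comment> \<open>With \<open>s\<close> mirrored, dominated convergence runs towards
    \<open>at_top\<close>. The indicator remains 1 at \<open>t = 0\<close>, so pointwise convergence
    to 0 is claimed only off this null set.\<close>
  have "((\<lambda>s. LBINT t. indicator {t. \<bar>t\<bar> \<le> exp (- s)} t * \<phi> t) \<longlongrightarrow> (LBINT t::real. 0)) at_top"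
  proof (rule integral_dominated_convergence_at_top[OF _ _ int])
    show "\<forall>\<^sub>F s in at_top. AE t in lborel. norm (indicator {t. \<bar>t\<bar> \<le> exp (- s)} t * \<phi> t) \<le> \<phi> t"
      using nonneg by (auto simp: indicator_def)
    have "AE t in lborel. t \<noteq> (0 :: real)" by (rule AE_lborel_singleton)
    then show "AE t in lborel. ((\<lambda>s. indicator {t. \<bar>t\<bar> \<le> exp (- s)} t * \<phi> t) \<longlongrightarrow> 0) at_top"
    proof eventually_elim
      fix t :: real assume "t \<noteq> 0"
      moreover have "((\<lambda>u::real. exp (- u)) \<longlongrightarrow> 0) at_top"
        by (intro filterlim_compose[OF exp_at_bot] filterlim_uminus_at_bot_at_top)
      ultimately have "\<forall>\<^sub>F s in at_top. exp (- s) < \<bar>t\<bar>"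
        by (intro order_tendstoD) auto
      then have "\<forall>\<^sub>F s in at_top. indicator {t. \<bar>t\<bar> \<le> exp (- s)} t * \<phi> t = 0"
        by eventually_elim simp
      then show "((\<lambda>s. indicator {t. \<bar>t\<bar> \<le> exp (- s)} t * \<phi> t) \<longlongrightarrow> 0) at_top"
        by (rule tendsto_eventually)
    qed
  qed (use ball_integrable in auto)
  then have "((\<lambda>s. 1 / pi * (LBINT t. indicator {t. \<bar>t\<bar> \<le> exp (- s)} t * \<phi> t)) \<longlongrightarrow> 1 / pi * 0) at_top"
    by (intro tendsto_mult_left) simp
  then show ?thesis
    by (simp add: log_mass_def[abs_def] set_lebesgue_integral_def filterlim_at_bot_mirror)
qed

end

text \<open>The integrand may blow up at 0, so the fundamental theorem is applied on
  \<open>{x / 2..2 * x}\<close> and the integral over \<open>{0<..x / 2}\<close> enters as a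
  constant. It serves both \<open>hinv\<close> and \<open>log_mass\<close>.\<close>

lemma integral_from_0_has_derivative:
  fixes f :: "real \<Rightarrow> real"
  assumes int: "\<And>b. set_integrable lborel {0<..b} f" and cont: "continuous_on {0<..} f" and x: "0 < x"
  shows "((\<lambda>x. LBINT t:{0<..x}. f t) has_real_derivative f x) (at x)"
proof -
  let ?a = "x / 2" and ?b = "2 * x"
  have "((\<lambda>u. LBINT y=?a..u. f y) has_vector_derivative f x) (at x within {?a..?b})"
    by (rule interval_integral_FTC2) (use x in \<open>auto intro!: continuous_on_subset[OF cont]\<close>)
  then have d: "((\<lambda>u. LBINT y=?a..u. f y) has_real_derivative f x) (at x)"
    using x by (simp add: at_within_Icc_at has_real_derivative_iff_has_vector_derivative)
  have "((\<lambda>u. (LBINT t:{0<..?a}. f t) + (LBINT y=?a..u. f y)) has_real_derivative f x) (at x)"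
    using DERIV_add[OF DERIV_const d] by simp
  then show ?thesis
  proof (rule has_field_derivative_transform_within_open[where S = "{?a<..<?b}"])
    fix y assume y: "y \<in> {?a<..<?b}"
    have "{0<..y} = {0<..?a} \<union> {?a<..y}" using x y by auto
    moreover have "(LBINT t:({0<..?a} \<union> {?a<..y}). f t) = (LBINT t:{0<..?a}. f t) + (LBINT t:{?a<..y}. f t)"
      by (rule set_integral_Un) (use int x in \<open>auto intro: set_integrable_subset[OF int[of y]]\<close>)
    ultimately show "(LBINT t:{0<..?a}. f t) + (LBINT t=?a..y. f t) = (LBINT t:{0<..y}. f t)"
      using y by (simp add: interval_integral_Ioc)
  qed (use x in auto)
qed

lemma (in log_density) log_mass_deriv:
  assumes even: "\<And>t. \<phi> (- t) = \<phi> t" and cont: "continuous_on {0<..} \<phi>"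
  shows "(log_mass \<phi> has_real_derivative 2 / pi * (exp s * \<phi> (exp s))) (at s)"
proof -
  have si: "set_integrable lborel S \<phi>" if "S \<in> sets lborel" for S
    using set_integrable_subset[of lborel UNIV \<phi> S] that int by (simp add: set_integrable_def)
  have m: "log_mass \<phi> s = 2 / pi * (LBINT t:{0<..exp s}. \<phi> t)" for s
  proof -
    let ?f = "\<lambda>t. indicator {t. \<bar>t\<bar> \<le> exp s} t * \<phi> t"
    have eq: "indicator {0<..} t *\<^sub>R ?f t = indicator {0<..exp s} t *\<^sub>R \<phi> t" for t
      by (auto simp: indicator_def)
    have "set_integrable lborel {0<..} ?f"
      using si[of "{0<..exp s}"] unfolding set_integrable_def eq by simp
    from even_integral(2)[OF _ this] have "(LBINT t. ?f t) = 2 * (LBINT t:{0<..}. ?f t)"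
      by (simp add: even indicator_def)
    also have "(LBINT t:{0<..}. ?f t) = (LBINT t:{0<..exp s}. \<phi> t)"
      unfolding set_lebesgue_integral_def eq ..
    finally show ?thesis by (simp add: log_mass_def set_lebesgue_integral_def)
  qed
  have "((\<lambda>x. LBINT t:{0<..x}. \<phi> t) has_real_derivative \<phi> (exp s)) (at (exp s))"
    by (rule integral_from_0_has_derivative[OF si cont]) auto
  from DERIV_cmult[OF DERIV_chain2[OF this DERIV_exp], of "2 / pi"]
  show ?thesis unfolding m[abs_def] by (simp add: mult.commute)
qed

section \<open>Explicit integrals\<close>

lemma powr_integral_from_0:
  fixes r b :: real
  assumes r: "0 < r" and b: "0 < b"
  shows "set_integrable lborel {0<..b} (\<lambda>t. t powr (r - 1))"
    and "(LBINT t:{0<..b}. t powr (r - 1)) = b powr r / r"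
proof -
  let ?f = "\<lambda>t::real. t powr (r - 1)" and ?F = "\<lambda>t::real. t powr r / r"
  have F: "DERIV ?F t :> ?f t" if "0 < ereal t" "ereal t < ereal b" for t
    using that r by (auto intro!: derivative_eq_intros)
  have c: "isCont ?f t" if "0 < ereal t" "ereal t < ereal b" for t
    using that by (intro continuous_intros) auto
  have n: "AE t in lborel. 0 < ereal t \<longrightarrow> ereal t < ereal b \<longrightarrow> 0 \<le> ?f t" by simp
  have "(?F \<longlongrightarrow> 0 powr r / r) (at_right 0)"
  proof -
    have "((\<lambda>t::real. t powr r) \<longlongrightarrow> 0 powr r) (at_right 0)"
      by (rule tendsto_powr') (use r in \<open>auto intro: eventually_at_right_less eventually_mono[OF eventually_at_right_less] tendsto_ident_at\<close>)
    then show ?thesis using r by (intro tendsto_divide tendsto_const) auto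
  qed
  then have a: "((?F \<circ> real_of_ereal) \<longlongrightarrow> 0) (at_right 0)"
    by (simp add: zero_ereal_def ereal_tendsto_simps)
  have "(?F \<longlongrightarrow> b powr r / r) (at_left b)"
    using r b by (intro tendsto_intros) auto
  then have e: "((?F \<circ> real_of_ereal) \<longlongrightarrow> b powr r / r) (at_left (ereal b))"
    by (simp add: ereal_tendsto_simps)
  have ei: "einterval 0 (ereal b) = {0<..<b}" by (auto simp: einterval_def)
  have i: "set_integrable lborel {0<..<b} ?f" and v: "(LBINT t:{0<..<b}. ?f t) = b powr r / r"
    using interval_integral_FTC_nonneg[OF _ F c n a e] b
    by (auto simp: ei interval_lebesgue_integral_def)
  have eq: "{0<..b} = {0<..<b} \<union> {b}" using b by auto
  note s = set_integral_lborel_singleton[of b ?f]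
  show "set_integrable lborel {0<..b} ?f"
    unfolding eq by (rule set_integrable_Un[OF i s(1)]) auto
  show "(LBINT t:{0<..b}. ?f t) = b powr r / r"
    unfolding eq by (subst set_integral_Un[OF _ i s(1)]) (auto simp: v s(2))
qed

lemma set_integral_mono_subset:
  fixes f :: "real \<Rightarrow> real"
  assumes int: "set_integrable lborel B f" and A: "A \<in> sets lborel" "A \<subseteq> B"
    and nonneg: "\<And>t. t \<in> B \<Longrightarrow> 0 \<le> f t"
  shows "(LBINT t:A. f t) \<le> (LBINT t:B. f t)"
  unfolding set_lebesgue_integral_def
proof (rule integral_mono)
  show "integrable lborel (\<lambda>t. indicator A t *\<^sub>R f t)"
    using set_integrable_subset[OF int A] by (simp add: set_integrable_def)
  show "integrable lborel (\<lambda>t. indicator B t *\<^sub>R f t)"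
    using int by (simp add: set_integrable_def)
  show "indicator A t *\<^sub>R f t \<le> indicator B t *\<^sub>R f t" for t
    using A(2) nonneg by (auto simp: indicator_def)
qed

text \<open>The larger number \<open>z\<close> satisfies
  \<open>z\<^sup>2 \<le> x\<^sup>2 + y\<^sup>2 \<le> 2 * z\<^sup>2\<close>.\<close>

lemma half_ln_sum_squares_approx:
  fixes x y :: real
  assumes "0 < x" "0 < y"
  shows "\<bar>ln (x\<^sup>2 + y\<^sup>2) / 2 - max (ln x) (ln y)\<bar> \<le> ln 2 / 2"
proof -
  define z where "z = max x y"
  have z: "0 < z" "max (ln x) (ln y) = ln z" using assms by (auto simp: z_def max_def)
  have "x\<^sup>2 \<le> z\<^sup>2" "y\<^sup>2 \<le> z\<^sup>2" using assms by (auto simp: z_def)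
  moreover have "z\<^sup>2 \<le> x\<^sup>2 + y\<^sup>2" using assms by (auto simp: z_def max_def)
  ultimately have "z\<^sup>2 \<le> x\<^sup>2 + y\<^sup>2" "x\<^sup>2 + y\<^sup>2 \<le> 2 * z\<^sup>2" by linarith+
  then have "ln (z\<^sup>2) \<le> ln (x\<^sup>2 + y\<^sup>2)" "ln (x\<^sup>2 + y\<^sup>2) \<le> ln (2 * z\<^sup>2)"
    using z assms by (auto simp: add_pos_pos)
  moreover have "ln (z\<^sup>2) = 2 * ln z" "ln (2 * z\<^sup>2) = ln 2 + 2 * ln z"
    using z by (simp_all add: ln_realpow ln_mult)
  ultimately show ?thesis unfolding z(2) by linarith
qed

text \<open>In this form \<open>- theta y\<close> is the integral of
  \<open>1 / (1 + t\<^sup>2)\<close> over \<open>{y<..}\<close>, so \<open>theta\<close> is a tail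
  integral just as \<open>Ffun\<close> is.\<close>

lemma theta_eq_arctan: "theta x = arctan x - pi / 2"
proof (cases x "0 :: real" rule: linorder_cases)
  case less
  have "arctan (- 1 / x) = arctan (inverse (- x))" by (simp add: inverse_eq_divide)
  also have "\<dots> = pi / 2 - arctan (- x)" using less by (intro Complex_Transcendental.arctan_inverse) simp
  finally show ?thesis using less by (simp add: theta_def arctan_minus)
next
  case greater
  have "arctan (- 1 / x) = - arctan (inverse x)" by (simp add: inverse_eq_divide arctan_minus)
  also have "arctan (inverse x) = pi / 2 - arctan x" using greater by (rule Complex_Transcendental.arctan_inverse)
  finally show ?thesis using greater by (simp add: theta_def)
qed (simp add: theta_def)

lemma arctan_tail_integral:
  fixes y :: real
  shows "set_integrable lborel {y<..} (\<lambda>t. 1 / (1 + t\<^sup>2))"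
    and "(LBINT t:{y<..}. 1 / (1 + t\<^sup>2)) = pi / 2 - arctan y"
proof -
  have F: "DERIV arctan t :> 1 / (1 + t\<^sup>2)" for t :: real
    by (auto intro!: derivative_eq_intros simp: inverse_eq_divide)
  have c: "isCont (\<lambda>t. 1 / (1 + t\<^sup>2)) t" for t :: real
    by (intro continuous_intros) (simp add: add_nonneg_eq_0_iff)
  have n: "AE t in lborel. ereal y < ereal t \<longrightarrow> ereal t < \<infinity> \<longrightarrow> 0 \<le> 1 / (1 + t\<^sup>2)" by simp
  have a: "((arctan \<circ> real_of_ereal) \<longlongrightarrow> arctan y) (at_right (ereal y))"
    by (auto simp: ereal_tendsto_simps intro!: tendsto_intros)
  have b: "((arctan \<circ> real_of_ereal) \<longlongrightarrow> pi / 2) (at_left \<infinity>)"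
    by (simp add: ereal_tendsto_simps tendsto_arctan_at_top)
  have ei: "einterval (ereal y) \<infinity> = {y<..}" by (auto simp: einterval_def)
  show "set_integrable lborel {y<..} (\<lambda>t. 1 / (1 + t\<^sup>2))"
       "(LBINT t:{y<..}. 1 / (1 + t\<^sup>2)) = pi / 2 - arctan y"
    using interval_integral_FTC_nonneg[OF _ F c n a b] by (auto simp: ei interval_lebesgue_integral_def)
qed

text \<open>The density belonging to \<open>b * theta\<close>. It satisfies the same kind of
  estimates as \<open>F'\<close>, with centre 0 and decay rate 1, because
  \<open>\<bar>t\<bar> / (1 + t\<^sup>2)\<close> is at most the smaller of
  \<open>\<bar>t\<bar>\<close> and \<open>1 / \<bar>t\<bar>\<close>.\<close>

lemma cauchy_density:
  fixes b :: real
  assumes b: "0 \<le> b"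
  defines "\<psi> \<equiv> \<lambda>t::real. b * (1 / (1 + t\<^sup>2))"
  shows "log_density \<psi>" "(LBINT t. \<psi> t) = b * pi"
    and "\<And>t. \<psi> t * \<bar>t\<bar> \<le> b"
    and "(LBINT t. \<bar>\<psi> t * (ln (abs t) - 0)\<bar>) \<le> 16 * b"
proof -
  have m: "\<psi> \<in> borel_measurable borel" unfolding \<psi>_def by measurable
  have nn: "0 \<le> \<psi> t" for t using b by (simp add: \<psi>_def)
  have d: "\<bar>\<psi> t\<bar> * \<bar>t\<bar> \<le> b * exp (- (1 * \<bar>ln (abs t) - 0\<bar>))" if "t \<noteq> 0" for t
  proof -
    have "\<bar>t\<bar> / (1 + t\<^sup>2) \<le> exp (- \<bar>ln (abs t)\<bar>)"
    proof (cases "\<bar>t\<bar> \<le> 1")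
      case True
      then have "ln (abs t) \<le> 0" using that by simp
      then have "exp (- \<bar>ln (abs t)\<bar>) = \<bar>t\<bar>" using that by simp
      moreover have "\<bar>t\<bar> / (1 + t\<^sup>2) \<le> \<bar>t\<bar> / 1" by (intro divide_left_mono) (auto simp: add_pos_nonneg)
      ultimately show ?thesis by simp
    next
      case False
      then have "0 \<le> ln (abs t)" by simp
      then have "exp (- \<bar>ln (abs t)\<bar>) = 1 / \<bar>t\<bar>" using that by (simp add: exp_minus inverse_eq_divide)
      moreover have "\<bar>t\<bar> * \<bar>t\<bar> \<le> 1 + t\<^sup>2" by (simp add: power2_eq_square flip: abs_mult)
      then have "\<bar>t\<bar> / (1 + t\<^sup>2) \<le> 1 / \<bar>t\<bar>" using that by (simp add: divide_simps add_pos_nonneg)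
      ultimately show ?thesis by simp
    qed
    then have "b * (\<bar>t\<bar> / (1 + t\<^sup>2)) \<le> b * exp (- \<bar>ln (abs t)\<bar>)" using b by (rule mult_left_mono)
    then show ?thesis using b by (simp add: \<psi>_def abs_mult)
  qed
  note * = log_decay_integrable[OF m zero_less_one d]
  show "log_density \<psi>"
    by standard (use * nn in auto)
  have pos: "set_integrable lborel {0<..} \<psi>"
    unfolding \<psi>_def by (rule set_integrable_mult_right) (rule arctan_tail_integral)
  have "(LBINT t. \<psi> t) = 2 * (LBINT t:{0<..}. \<psi> t)"
    by (rule even_integral(2)[OF _ pos]) (simp add: \<psi>_def)
  also have "(LBINT t:{0<..}. \<psi> t) = b * (pi / 2)"
    unfolding \<psi>_def set_integral_mult_right arctan_tail_integral(2) by simp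
  finally show "(LBINT t. \<psi> t) = b * pi" by simp
  show "\<psi> t * \<bar>t\<bar> \<le> b" for t
  proof (cases "t = 0")
    case False
    have "b * exp (- (1 * \<bar>ln (abs t) - 0\<bar>)) \<le> b * 1" using b by (intro mult_left_mono) auto
    then show ?thesis using d[OF False] nn[of t] by simp
  qed (use b in simp)
  show "(LBINT t. \<bar>\<psi> t * (ln (abs t) - 0)\<bar>) \<le> 16 * b" using *(3) by simp
qed

section \<open>The profile\<close>

text \<open>Collects the consequences of the shape of \<open>G\<close> and the boundedness of
  \<open>g\<close>; the fixed-point equation enters in \<open>even_solution\<close>.\<close>

locale even_profile =
  fixes \<mu> \<nu> :: real and g :: "real \<Rightarrow> real"
  assumes mu: "1/2 < \<mu>" and nu: "0 < \<nu>" "\<nu> < 1/2"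
    and cont: "continuous_on UNIV g" and bdd: "bounded (range g)"
    and even: "g (- x) = g x"
    and mono: "mono_on {0..} (\<lambda>x. g x + (\<mu> - \<nu>) / 2 * ln (x\<^sup>2 + 1))"
begin

definition G :: "real \<Rightarrow> real" where
  "G x = g x + (\<mu> - \<nu>) / 2 * ln (x\<^sup>2 + 1)"

abbreviation "h \<equiv> hinv \<mu> \<nu> g"
abbreviation "h' \<equiv> hinv_deriv \<mu> \<nu> g"
abbreviation "dens \<equiv> Fdens \<mu> \<nu> g"

definition phi :: "real \<Rightarrow> real" where
  "phi t = kappa \<mu> \<nu> g * dens t"

lemma G_mono: "0 \<le> x \<Longrightarrow> x \<le> y \<Longrightarrow> G x \<le> G y"
  using mono by (auto simp: G_def mono_on_def)

lemma G_cont: "continuous_on UNIV G"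
  unfolding G_def[abs_def]
  by (intro continuous_intros cont) (auto simp: add_nonneg_eq_0_iff)

section \<open>Growth of the function \<open>hinv\<close> and its derivative\<close>

lemma hinv_deriv_eq: "0 < x \<Longrightarrow> h' x = x powr (\<nu> - 1) * exp (G x)"
proof -
  have "0 < x\<^sup>2 + 1" by (simp add: add_nonneg_pos)
  then have "(x\<^sup>2 + 1) powr ((\<mu> - \<nu>) / 2) * exp (g x) = exp (G x)"
    by (simp add: powr_def G_def exp_add add.commute)
  then show "0 < x \<Longrightarrow> h' x = x powr (\<nu> - 1) * exp (G x)"
    by (simp add: hinv_deriv_def mult.assoc)
qed

lemma hinv_deriv_even: "h' (- x) = h' x"
  by (simp add: hinv_deriv_def even)

lemma hinv_deriv_pos: "0 < x \<Longrightarrow> 0 < h' x"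
  by (simp add: hinv_deriv_eq)

lemma hinv_deriv_cont: "continuous_on {0<..} h'"
proof -
  have "continuous_on {0<..} (\<lambda>x. x powr (\<nu> - 1) * exp (G x))"
    by (intro continuous_intros continuous_on_subset[OF G_cont]) auto
  then show ?thesis
    by (rule continuous_on_eq) (simp add: hinv_deriv_eq)
qed

lemma hinv_deriv_integrable: "set_integrable lborel {0<..b} h'"
proof (cases "0 < b")
  case True
  have "set_integrable lborel {0<..b} (\<lambda>t. exp (G b) * t powr (\<nu> - 1))"
    using powr_integral_from_0(1)[OF nu(1) True] by (rule set_integrable_mult_right)
  then show ?thesis
  proof (rule set_integrable_bound)
    show "set_borel_measurable lborel {0<..b} h'"
    proof -
      have "continuous_on {0<..b} h'" by (rule continuous_on_subset[OF hinv_deriv_cont]) auto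
      then show ?thesis
        unfolding set_borel_measurable_def using borel_measurable_continuous_on_indicator[of "{0<..b}" h'] by simp
    qed
    show "AE t in lborel. t \<in> {0<..b} \<longrightarrow> norm (h' t) \<le> norm (exp (G b) * t powr (\<nu> - 1))"
      by (intro AE_I2) (auto simp: hinv_deriv_eq abs_mult G_mono)
  qed
qed (auto simp: set_integrable_def)

lemma hinv_eq: "0 \<le> x \<Longrightarrow> h x = (LBINT t:{0<..x}. h' t)"
  using interval_integral_Ioc[of 0 x h'] by (simp add: hinv_def zero_ereal_def)

lemma hinv_odd: "h (- x) = - h x"
proof -
  have "(LBINT t=0..ereal (- x). h' t) = - (LBINT t=ereal (- x)..0. h' t)"
    by (rule interval_integral_endpoints_reverse)
  also have "(LBINT t=ereal (- x)..0. h' t) = (LBINT t=0..ereal x. h' t)"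
    by (subst interval_integral_reflect) (simp add: hinv_deriv_even)
  finally show ?thesis by (simp add: hinv_def)
qed

lemma hinv_has_derivative:
  assumes "0 < x"
  shows "(h has_real_derivative h' x) (at x)"
  using integral_from_0_has_derivative[OF hinv_deriv_integrable hinv_deriv_cont assms]
  by (rule has_field_derivative_transform_within_open[where S = "{0<..}"]) (use assms in \<open>auto simp: hinv_eq\<close>)

lemma hinv_upper:
  assumes x: "0 < x"
  shows "h x \<le> x powr \<nu> / \<nu> * exp (G x)"
proof -
  have "h x \<le> (LBINT t:{0<..x}. exp (G x) * t powr (\<nu> - 1))"
    unfolding hinv_eq[OF less_imp_le[OF x]]
  proof (rule set_integral_mono[OF hinv_deriv_integrable])
    show "set_integrable lborel {0<..x} (\<lambda>t. exp (G x) * t powr (\<nu> - 1))"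
      using powr_integral_from_0(1)[OF nu(1) x] by (rule set_integrable_mult_right)
  qed (auto simp: hinv_deriv_eq G_mono)
  also have "\<dots> = exp (G x) * (x powr \<nu> / \<nu>)"
    unfolding set_integral_mult_right powr_integral_from_0(2)[OF nu(1) x] ..
  finally show ?thesis by (simp add: mult.commute)
qed

text \<open>Only the part of the integral over \<open>{x / 2<..x}\<close> is kept. There
  \<open>G\<close> is at least \<open>G (x / 2)\<close>, and the decreasing power is at least its
  value at \<open>x\<close>.\<close>

lemma hinv_lower:
  assumes x: "0 < x"
  shows "x powr \<nu> / 2 * exp (G (x / 2)) \<le> h x"
proof -
  let ?c = "x powr (\<nu> - 1) * exp (G (x / 2))"
  have "x powr \<nu> / 2 * exp (G (x / 2)) = (x / 2) * ?c"
    using x powr_add[of x 1 "\<nu> - 1"] by simp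
  also have "\<dots> = (LBINT t:{x / 2<..x}. ?c)"
    using x by (simp add: set_lebesgue_integral_def)
  also have "\<dots> \<le> (LBINT t:{x / 2<..x}. h' t)"
  proof (rule set_integral_mono)
    show "set_integrable lborel {x / 2<..x} (\<lambda>t. ?c)"
      unfolding set_integrable_def using x by (intro integrable_scaleR_left integrable_real_indicator) auto
    show "set_integrable lborel {x / 2<..x} h'"
      by (rule set_integrable_subset[OF hinv_deriv_integrable[of x]]) (use x in auto)
    show "?c \<le> h' t" if "t \<in> {x / 2<..x}" for t
    proof -
      have "x powr (\<nu> - 1) \<le> t powr (\<nu> - 1)" using that x nu by (intro powr_mono2') auto
      moreover have "exp (G (x / 2)) \<le> exp (G t)" using that x by (simp add: G_mono)
      ultimately show ?thesis using that x by (simp add: hinv_deriv_eq mult_mono)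
    qed
  qed
  also have "\<dots> \<le> (LBINT t:{0<..x}. h' t)"
    by (rule set_integral_mono_subset[OF hinv_deriv_integrable])
       (use x hinv_deriv_pos in \<open>auto intro: less_imp_le\<close>)
  finally show ?thesis using x by (simp add: hinv_eq)
qed

lemma hinv_pos:
  assumes "0 < x"
  shows "0 < h x"
proof -
  have "0 < x powr \<nu> / 2 * exp (G (x / 2))" using assms by simp
  also note hinv_lower[OF assms]
  finally show ?thesis .
qed

text \<open>The derivative is nonnegative exactly when \<open>\<nu> * h z \<le> z * h' z\<close>,
  and this is \<open>hinv_upper\<close> multiplied by \<open>\<nu>\<close>.\<close>

lemma hinv_ratio_mono:
  assumes x: "0 < x" "x \<le> y"
  shows "h x * x powr (- \<nu>) \<le> h y * y powr (- \<nu>)"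
proof (rule DERIV_nonneg_imp_nondecreasing[OF x(2)])
  fix z assume "x \<le> z" "z \<le> y"
  then have z: "0 < z" using x by simp
  have "((\<lambda>z. h z * z powr (- \<nu>)) has_real_derivative
      h' z * z powr (- \<nu>) + (- \<nu> * z powr (- \<nu> - 1)) * h z) (at z)"
    using z by (intro DERIV_mult hinv_has_derivative has_real_derivative_powr)
  moreover have "\<nu> * z powr (- \<nu> - 1) * h z \<le> h' z * z powr (- \<nu>)"
  proof -
    have "\<nu> * z powr (- \<nu> - 1) * h z \<le> \<nu> * z powr (- \<nu> - 1) * (z powr \<nu> / \<nu> * exp (G z))"
      using nu hinv_upper[OF z] by (intro mult_left_mono) auto
    also have "\<dots> = (z powr (- \<nu> - 1) * z powr \<nu>) * exp (G z)"
      using nu by simp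
    also have "z powr (- \<nu> - 1) * z powr \<nu> = z powr (\<nu> - 1) * z powr (- \<nu>)"
      by (simp flip: powr_add)
    finally show ?thesis using z by (simp add: hinv_deriv_eq mult_ac)
  qed
  ultimately show "\<exists>d. ((\<lambda>z. h z * z powr (- \<nu>)) has_real_derivative d) (at z) \<and> 0 \<le> d"
    by (intro exI conjI) auto
qed

section \<open>The unnormalised density: positivity, size, monotonicity and integrability\<close>

lemma dens_even: "dens (- t) = dens t"
  by (simp add: Fdens_def hinv_odd hinv_deriv_even)

lemma dens_eq: "0 < t \<Longrightarrow> dens t * t = 1 / (h t * h' t)"
  by (simp add: Fdens_def)

lemma dens_pos: "0 < t \<Longrightarrow> 0 < dens t"
  by (simp add: Fdens_def hinv_pos hinv_deriv_pos)

lemma dens_abs: "dens \<bar>t\<bar> = dens t"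
  by (simp add: abs_if dens_even)

lemma dens_nonneg: "0 \<le> dens t"
  \<comment> \<open>At \<open>0\<close> the density takes the value \<open>1 / 0 = 0\<close>;
    elsewhere evenness reduces to \<open>\<bar>t\<bar>\<close>.\<close>
  by (cases "t = 0") (simp_all add: Fdens_def[of _ _ _ 0] less_imp_le dens_pos flip: dens_abs[of t])

lemma dens_cont: "continuous_on {0<..} dens"
proof -
  have "continuous_on {0<..} h"
    using DERIV_isCont[OF hinv_has_derivative] by (intro continuous_at_imp_continuous_on ballI) simp
  then show ?thesis
    unfolding Fdens_def[abs_def]
    using hinv_pos hinv_deriv_pos
    by (intro continuous_on_divide continuous_on_mult continuous_on_const continuous_on_id hinv_deriv_cont)
       (auto simp: less_imp_neq[symmetric])
qed

lemma dens_measurable[measurable]: "dens \<in> borel_measurable borel"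
proof (rule borel_measurable_continuous_countable_exceptions)
  show "continuous_on (- {0}) dens"
  proof -
    have "continuous_on (- {0}) (\<lambda>t::real. dens \<bar>t\<bar>)"
      by (rule continuous_on_compose2[OF dens_cont]) (auto intro!: continuous_intros)
    then show ?thesis by (simp add: dens_abs)
  qed
qed simp

text \<open>One half of the Liouville comparison: up to a constant, \<open>h t * h' t\<close> is at
  most \<open>t powr (2 * \<nu> - 1) * exp (2 * G t)\<close>.\<close>

lemma dens_lower:
  assumes t: "0 < t"
  shows "\<nu> * exp ((1 - 2 * \<nu>) * ln t - 2 * G t) \<le> dens t * t"
proof -
  have "h t * h' t \<le> (t powr \<nu> / \<nu> * exp (G t)) * (t powr (\<nu> - 1) * exp (G t))"
    using hinv_upper[OF t] by (simp only: hinv_deriv_eq[OF t]) (intro mult_right_mono; simp)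
  also have "\<dots> = exp (- ((1 - 2 * \<nu>) * ln t - 2 * G t)) / \<nu>"
    using t by (simp add: powr_def algebra_simps flip: exp_add)
  finally have "h t * h' t \<le> exp (- ((1 - 2 * \<nu>) * ln t - 2 * G t)) / \<nu>" .
  then have "1 / (exp (- ((1 - 2 * \<nu>) * ln t - 2 * G t)) / \<nu>) \<le> 1 / (h t * h' t)"
    using hinv_pos[OF t] hinv_deriv_pos[OF t] by (intro divide_left_mono) (auto intro!: mult_pos_pos divide_pos_pos nu)
  then show ?thesis unfolding dens_eq[OF t] exp_minus by (simp add: field_simps)
qed

text \<open>The other half of the comparison. The lower bound for \<open>h\<close> leaves one
  \<open>G (t / 2)\<close> in place of \<open>G t\<close>, a discrepancy absorbed in
  \<open>phi_decay\<close>.\<close>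

lemma dens_upper:
  assumes t: "0 < t"
  shows "dens t * t \<le> 2 * exp ((1 - 2 * \<nu>) * ln t - G t - G (t / 2))"
proof -
  have "exp (- ((1 - 2 * \<nu>) * ln t - G t - G (t / 2))) / 2
      = (t powr \<nu> / 2 * exp (G (t / 2))) * (t powr (\<nu> - 1) * exp (G t))"
    using t by (simp add: powr_def algebra_simps flip: exp_add)
  also have "\<dots> \<le> h t * h' t"
    using hinv_lower[OF t] by (simp only: hinv_deriv_eq[OF t]) (intro mult_right_mono; simp)
  finally have "exp (- ((1 - 2 * \<nu>) * ln t - G t - G (t / 2))) / 2 \<le> h t * h' t" .
  then have "1 / (h t * h' t) \<le> 1 / (exp (- ((1 - 2 * \<nu>) * ln t - G t - G (t / 2))) / 2)"
    using hinv_pos[OF t] hinv_deriv_pos[OF t] by (intro divide_left_mono) (auto intro!: mult_pos_pos)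
  then show ?thesis unfolding dens_eq[OF t] exp_minus by (simp add: field_simps)
qed

text \<open>The scaled density is the reciprocal of
  \<open>(h z * z powr (- \<nu>)) * exp (G z)\<close>, a product of two positive increasing
  factors.\<close>

lemma dens_scaled_antimono:
  assumes t: "0 < t" "t \<le> x"
  shows "dens x * x powr (2 * \<nu>) \<le> dens t * t powr (2 * \<nu>)"
proof -
  have eq: "dens z * z powr (2 * \<nu>) = 1 / ((h z * z powr (- \<nu>)) * exp (G z))" if z: "0 < z" for z
  proof -
    have "z * h' z = z powr \<nu> * exp (G z)"
      using z powr_add[of z 1 "\<nu> - 1"] by (simp add: hinv_deriv_eq)
    then have "dens z = 1 / (h z * (z powr \<nu> * exp (G z)))"
      by (metis Fdens_def mult.assoc mult.commute)
    moreover have "z powr (2 * \<nu>) = z powr \<nu> * z powr \<nu>" by (simp flip: powr_add)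
    moreover have "z powr (- \<nu>) = 1 / z powr \<nu>" by (simp add: powr_minus inverse_eq_divide)
    ultimately show ?thesis using z by simp
  qed
  have x: "0 < x" using t by simp
  have "1 / ((h x * x powr (- \<nu>)) * exp (G x)) \<le> 1 / ((h t * t powr (- \<nu>)) * exp (G t))"
    using t x hinv_pos[OF t(1)] hinv_pos[OF x] hinv_ratio_mono[OF t] G_mono[of t x]
    by (intro divide_left_mono mult_mono[where b = "_ * _"] mult_pos_pos) auto
  then show ?thesis using eq[OF t(1)] eq[OF x] by simp
qed

text \<open>A qualitative estimate whose constant depends on the bound \<open>M\<close> of
  \<open>g\<close>; it serves integrability only. From
  \<open>G x \<ge> (\<mu> - \<nu>) * max 0 (ln x) - M\<close> the exponent in \<open>ln t\<close> is
  \<open>1 - 2 * \<nu>\<close> near 0 and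
  \<open>(1 - 2 * \<nu>) - 2 * (\<mu> - \<nu>) = 1 - 2 * \<mu>\<close> at infinity.\<close>

lemma dens_log_decay:
  obtains C where "\<And>t. t \<noteq> 0 \<Longrightarrow>
    \<bar>dens t\<bar> * \<bar>t\<bar> \<le> C * exp (- (min (1 - 2 * \<nu>) (2 * \<mu> - 1) * \<bar>ln (abs t) - 0\<bar>))"
proof -
  obtain M where M: "\<And>x. \<bar>g x\<bar> \<le> M" using bdd by (auto simp: bounded_iff)
  define b where "b = \<mu> - \<nu>"
  define \<delta> where "\<delta> = min (1 - 2 * \<nu>) (2 * \<mu> - 1)"
  have b: "0 < b" using mu nu by (simp add: b_def)
  have G_ge: "b * max 0 (ln x) - M \<le> G x" if "0 < x" for x
  proof -
    have "0 \<le> ln (x\<^sup>2 + 1)" by simp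
    moreover have "ln (x\<^sup>2) \<le> ln (x\<^sup>2 + 1)" using that by (subst ln_le_cancel_iff) (auto simp: add_nonneg_pos)
    then have "2 * ln x \<le> ln (x\<^sup>2 + 1)" using that by (simp add: ln_realpow)
    ultimately have "max 0 (ln x) \<le> ln (x\<^sup>2 + 1) / 2" by linarith
    then have "b * max 0 (ln x) \<le> b * (ln (x\<^sup>2 + 1) / 2)" using b by (intro mult_left_mono) auto
    then show ?thesis using M[of x] by (simp add: G_def b_def)
  qed
  have pos: "dens t * t \<le> 2 * exp (b * ln 2 + 2 * M) * exp (- (\<delta> * \<bar>ln t\<bar>))" if t: "0 < t" for t
  proof -
    have "0 \<le> ln (2::real)" by simp
    then have "max 0 (ln t) - ln 2 \<le> max 0 (ln t - ln 2)" by linarith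
    then have "b * (max 0 (ln t) - ln 2) \<le> b * max 0 (ln (t / 2))"
      using b t by (intro mult_left_mono) (auto simp: ln_div)
    then have "b * max 0 (ln t) - b * ln 2 - M \<le> G (t / 2)"
      using G_ge[of "t / 2"] t by (simp add: right_diff_distrib)
    moreover have "(1 - 2 * \<nu>) * ln t - 2 * (b * max 0 (ln t)) \<le> - (\<delta> * \<bar>ln t\<bar>)"
    proof (cases "0 \<le> ln t")
      case True
      have "\<delta> * ln t \<le> (2 * \<mu> - 1) * ln t" using True by (intro mult_right_mono) (auto simp: \<delta>_def)
      then show ?thesis using True by (simp add: b_def algebra_simps)
    next
      case False
      have "\<delta> * (- ln t) \<le> (1 - 2 * \<nu>) * (- ln t)" using False by (intro mult_right_mono) (auto simp: \<delta>_def)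
      then show ?thesis using False by simp
    qed
    ultimately have "(1 - 2 * \<nu>) * ln t - G t - G (t / 2) \<le> (b * ln 2 + 2 * M) + - (\<delta> * \<bar>ln t\<bar>)"
      using G_ge[OF t] by linarith
    then have "exp ((1 - 2 * \<nu>) * ln t - G t - G (t / 2)) \<le> exp (b * ln 2 + 2 * M) * exp (- (\<delta> * \<bar>ln t\<bar>))"
      unfolding exp_add[symmetric] by simp
    then show ?thesis using dens_upper[OF t] by linarith
  qed
  have "\<bar>dens t\<bar> * \<bar>t\<bar> \<le> (2 * exp (b * ln 2 + 2 * M)) * exp (- (\<delta> * \<bar>ln (abs t) - 0\<bar>))" if "t \<noteq> 0" for t
    using pos[of "\<bar>t\<bar>"] that dens_nonneg[of t] by (simp add: dens_abs)
  then show ?thesis using that unfolding \<delta>_def by blast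
qed

lemma decay_rate_pos: "0 < min (1 - 2 * \<nu>) (2 * \<mu> - 1)"
  using mu nu by simp

lemma dens_integrable: "integrable lborel dens"
  and dens_ln_integrable: "integrable lborel (\<lambda>t. dens t * ln (abs t))"
proof -
  obtain C where "\<And>t. t \<noteq> 0 \<Longrightarrow>
    \<bar>dens t\<bar> * \<bar>t\<bar> \<le> C * exp (- (min (1 - 2 * \<nu>) (2 * \<mu> - 1) * \<bar>ln (abs t) - 0\<bar>))"
    using dens_log_decay by blast
  note * = log_decay_integrable[OF dens_measurable decay_rate_pos this]
  show "integrable lborel dens" by (rule *(1))
  show "integrable lborel (\<lambda>t. dens t * ln (abs t))" using *(2) by simp
qed

text \<open>Positivity on \<open>{0<..<1}\<close> excludes zero mass, so the quotient defining
  \<open>kappa\<close> is a genuine one and not the value 0 of a division by zero.\<close>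

lemma dens_mass_pos: "0 < (LBINT t. dens t)"
proof -
  have "(LBINT t. dens t) \<noteq> 0"
  proof
    assume "(LBINT t. dens t) = 0"
    then have "AE t in lborel. dens t = 0"
      using integral_nonneg_eq_0_iff_AE[OF dens_integrable] dens_nonneg by simp
    then have "AE t in lborel. t \<notin> {0<..<1::real}"
      by eventually_elim (use dens_pos in fastforce)
    then have "emeasure lborel {0<..<1::real} = 0"
      by (subst (asm) AE_iff_measurable[where N = "{0<..<1}"]) auto
    then show False by simp
  qed
  moreover have "0 \<le> (LBINT t. dens t)"
    by (rule Bochner_Integration.integral_nonneg) (rule dens_nonneg)
  ultimately show ?thesis by linarith
qed

section \<open>The normalised density \<open>F'\<close>\<close>

lemma kappa_pos: "0 < kappa \<mu> \<nu> g"
  using dens_mass_pos mu nu by (simp add: kappa_def)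

lemma phi_mass: "(LBINT t. phi t) = (\<mu> - \<nu>) * pi"
  using dens_mass_pos by (simp add: phi_def[abs_def] kappa_def)

lemma phi_even: "phi (- t) = phi t"
  by (simp add: phi_def dens_even)

lemma phi_cont: "continuous_on {0<..} phi"
  unfolding phi_def[abs_def] by (intro continuous_intros dens_cont)

sublocale log_density phi
proof
  show "0 \<le> phi t" for t
    using kappa_pos dens_nonneg by (simp add: phi_def less_imp_le)
  show "integrable lborel phi" unfolding phi_def[abs_def] by (intro integrable_mult_right dens_integrable)
  show "integrable lborel (\<lambda>t. phi t * ln (abs t))"
    unfolding phi_def[abs_def] mult.assoc by (intro integrable_mult_right dens_ln_integrable)
qed

text \<open>Because \<open>phi t * t powr (2 * \<nu>)\<close> decreases, \<open>phi\<close> on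
  \<open>{0<..x}\<close> is at least \<open>phi x * (x / t) powr (2 * \<nu>)\<close>. Integrating
  gives \<open>phi x * x / (1 - 2 * \<nu>)\<close>, which is at most half of the total mass. The
  bound is free of \<open>g\<close>.\<close>

lemma phi_bound: "phi t * \<bar>t\<bar> \<le> (1 - 2 * \<nu>) * (\<mu> - \<nu>) * pi / 2"
proof -
  let ?r = "1 - 2 * \<nu>"
  have r: "0 < ?r" using nu by simp
  have si: "set_integrable lborel S phi" if "S \<in> sets lborel" for S
    using set_integrable_subset[of lborel UNIV phi S] that int by (simp add: set_integrable_def)
  have pos: "phi x * x \<le> ?r * (\<mu> - \<nu>) * pi / 2" if x: "0 < x" for x
  proof -
    have "(phi x * x powr (2 * \<nu>)) * (x powr ?r / ?r)
        = (LBINT t:{0<..x}. (phi x * x powr (2 * \<nu>)) * t powr (?r - 1))"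
      unfolding set_integral_mult_right powr_integral_from_0(2)[OF r x] ..
    also have "\<dots> \<le> (LBINT t:{0<..x}. phi t)"
    proof (rule set_integral_mono)
      show "set_integrable lborel {0<..x} (\<lambda>t. (phi x * x powr (2 * \<nu>)) * t powr (?r - 1))"
        using powr_integral_from_0(1)[OF r x] by (rule set_integrable_mult_right)
      show "set_integrable lborel {0<..x} phi" by (rule si) simp
      fix t assume "t \<in> {0<..x}"
      then have t: "0 < t" "t \<le> x" by auto
      have "phi x * x powr (2 * \<nu>) \<le> phi t * t powr (2 * \<nu>)"
        using dens_scaled_antimono[OF t] kappa_pos by (simp add: phi_def mult.assoc)
      then have "(phi x * x powr (2 * \<nu>)) * t powr (?r - 1) \<le> (phi t * t powr (2 * \<nu>)) * t powr (?r - 1)"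
        by (rule mult_right_mono) simp
      also have "\<dots> = phi t" using t by (simp add: mult.assoc flip: powr_add)
      finally show "(phi x * x powr (2 * \<nu>)) * t powr (?r - 1) \<le> phi t" .
    qed
    also have "\<dots> \<le> (LBINT t:{0<..}. phi t)"
      by (rule set_integral_mono_subset[OF si]) (auto simp: nonneg)
    also have "\<dots> = (\<mu> - \<nu>) * pi / 2"
      using even_integral(2)[OF phi_even si[of "{0<..}"]] phi_mass by simp
    also have "(phi x * x powr (2 * \<nu>)) * (x powr ?r / ?r) = phi x * x / ?r"
      using x powr_add[of x "2 * \<nu>" ?r] by simp
    finally show ?thesis using r by (simp add: field_simps)
  qed
  show ?thesis
  proof (cases "t = 0")
    case True
    then show ?thesis using mu nu by simp
  next
    case False
    have "phi \<bar>t\<bar> = phi t" by (simp add: phi_def dens_abs)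
    then show ?thesis using pos[of "\<bar>t\<bar>"] False by simp
  qed
qed

lemma log_mass_le: "log_mass phi s \<le> \<mu> - \<nu>"
proof -
  have "(LBINT t:{t. \<bar>t\<bar> \<le> exp s}. phi t) \<le> (LBINT t. phi t)"
    unfolding set_lebesgue_integral_def real_scaleR_def
    by (rule integral_mono[OF ball_integrable int]) (auto simp: indicator_def nonneg)
  then show ?thesis
    unfolding log_mass_def phi_mass by (simp add: field_simps)
qed

end

text \<open>The first term is \<open>16 * Q / pi\<close> with \<open>Q\<close> from
  \<open>phi_bound\<close>. The second combines two errors \<open>16 * (\<mu> - \<nu>) / pi\<close>
  for the Cauchy density, from the change of kernel and from concentrating the mass. The third
  compares \<open>ln (x\<^sup>2 + 1) / 2\<close> with \<open>max (ln x) 0\<close>.\<close>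

definition potential_error :: "real \<Rightarrow> real \<Rightarrow> real" where
  "potential_error \<mu> \<nu> = 8 * (1 - 2 * \<nu>) * (\<mu> - \<nu>) + 32 * (\<mu> - \<nu>) / pi + (\<mu> - \<nu>) * (ln 2 / 2)"

text \<open>The next four constants are \<open>c1\<close>, \<open>c2\<close>, \<open>d\<close> and the prefactor in \<open>liouville_comparison_decay\<close>.\<close>

definition decay_lower :: "real \<Rightarrow> real \<Rightarrow> real" where
  "decay_lower \<mu> \<nu> = \<nu> * exp (- (2 * potential_error \<mu> \<nu>))"

definition decay_upper :: "real \<Rightarrow> real \<Rightarrow> real" where
  "decay_upper \<mu> \<nu> = 2 * exp (2 * potential_error \<mu> \<nu> + (\<mu> - \<nu>) * ln 2)"

definition decay_rate :: "real \<Rightarrow> real \<Rightarrow> real" where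
  "decay_rate \<mu> \<nu> = decay_lower \<mu> \<nu> * ((2 * (\<mu> - \<nu>) - (1 - 2 * \<nu>))\<^sup>2 / (4 * decay_upper \<mu> \<nu>))
     * exp (- (2 * (\<mu> - \<nu>)))"

definition decay_const :: "real \<Rightarrow> real \<Rightarrow> real" where
  "decay_const \<mu> \<nu> = decay_upper \<mu> \<nu> * ((1 - 2 * \<nu>) * (\<mu> - \<nu>)) / decay_lower \<mu> \<nu> * exp (2 * decay_rate \<mu> \<nu>)"

text \<open>The middle term is the spread bound \<open>16 * C / \<delta>\<^sup>2\<close> of
  \<open>log_decay_integrable\<close>, divided by \<open>pi\<close>, for the decay of
  \<open>phi\<close>. The last term compares \<open>max (ln x) (ln x0)\<close> with
  \<open>ln (x\<^sup>2 + x0\<^sup>2) / 2\<close>.\<close>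

definition profile_bound :: "real \<Rightarrow> real \<Rightarrow> real" where
  "profile_bound \<mu> \<nu> = potential_error \<mu> \<nu> + 16 * (pi / 2 * decay_const \<mu> \<nu>) / (2 * decay_rate \<mu> \<nu>)\<^sup>2 / pi
     + (\<mu> - \<nu>) * (ln 2 / 2)"

section \<open>Consequences of the fixed-point equation\<close>

locale even_solution = even_profile +
  assumes solves: "solves_312 \<mu> \<nu> g"
begin

lemma decay_rate_positive: "0 < decay_rate \<mu> \<nu>"
  using mu nu by (simp add: decay_rate_def decay_lower_def decay_upper_def)

text \<open>\<open>F - (\<mu> - \<nu>) * theta\<close> is minus the tail integral of
  \<open>phi - \<psi>\<close>, which has total mass 0, so \<open>g\<close> is a difference of two
  logarithmic potentials. The potential of the Cauchy density \<open>\<psi>\<close> is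
  \<open>b * max (ln x) 0\<close> up to a bounded error and is compensated by the logarithm added in
  \<open>G\<close>.\<close>

lemma G_approx_max_potential:
  assumes x: "0 < x"
  shows "\<bar>G x - max_potential phi (ln x)\<bar> \<le> potential_error \<mu> \<nu>"
proof -
  define b where "b = \<mu> - \<nu>"
  define \<psi> where "\<psi> t = b * (1 / (1 + t\<^sup>2))" for t :: real
  have b: "0 \<le> b" using mu nu by (simp add: b_def)
  note cauchy = cauchy_density[OF b, folded \<psi>_def]
  interpret \<psi>: log_density \<psi> by (rule cauchy(1))
  note P = log_potential_approx[OF phi_bound x]
  note T = \<psi>.log_potential_approx[OF cauchy(3) x]
  let ?f = "\<lambda>t. phi t - \<psi> t"
  have "hilbert_pv (\<lambda>y. Ffun \<mu> \<nu> g y - b * theta y) x (g x)"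
    using solves by (simp add: solves_312_def b_def)
  moreover have "Ffun \<mu> \<nu> g y - b * theta y = - (LBINT t:{y<..}. ?f t)" for y
  proof -
    have i: "set_integrable lborel {y<..} f" if "integrable lborel f" for f :: "real \<Rightarrow> real"
      using set_integrable_subset[of lborel UNIV f "{y<..}"] that by (simp add: set_integrable_def)
    have "(LBINT t:{y<..}. ?f t) = (LBINT t:{y<..}. phi t) - (LBINT t:{y<..}. \<psi> t)"
      by (rule set_integral_diff(2)[OF i[OF int] i[OF \<psi>.int]])
    moreover have "(LBINT t:{y<..}. \<psi> t) = - (b * theta y)"
      unfolding \<psi>_def set_integral_mult_right arctan_tail_integral(2) theta_eq_arctan by (simp add: algebra_simps)
    ultimately show ?thesis by (simp add: Ffun_def phi_def)
  qed
  ultimately have hil: "hilbert_pv (\<lambda>y. - (LBINT t:{y<..}. ?f t)) x (g x)" by simp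
  have ln_int: "integrable lborel (\<lambda>t. ?f t * ln (abs (x - t)))"
    using P(1) T(1) by (simp add: left_diff_distrib)
  have "g x = 1 / pi * (LBINT t. ?f t * ln (abs (x - t)))"
  proof (rule hilbert_pv_log_potential[OF _ _ ln_int hil])
    show "integrable lborel ?f" using int \<psi>.int by simp
    show "(LBINT t. ?f t) = 0"
      using int \<psi>.int phi_mass cauchy(2) by (simp add: b_def)
  qed
  also have "\<dots> = 1 / pi * (LBINT t. phi t * ln (abs (x - t))) - 1 / pi * (LBINT t. \<psi> t * ln (abs (x - t)))"
    using P(1) T(1) by (simp add: left_diff_distrib diff_divide_distrib)
  finally have g: "g x = 1 / pi * (LBINT t. phi t * ln (abs (x - t))) - 1 / pi * (LBINT t. \<psi> t * ln (abs (x - t)))" .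
  have "\<bar>max_potential \<psi> (ln x) - b * max (ln x) 0\<bar> \<le> 16 * b / pi"
    by (rule \<psi>.max_potential_approx[OF cauchy(2,4)])
  moreover have "\<bar>b * (ln (x\<^sup>2 + 1) / 2) - b * max (ln x) 0\<bar> \<le> b * (ln 2 / 2)"
  proof -
    have "\<bar>ln (x\<^sup>2 + 1) / 2 - max (ln x) 0\<bar> \<le> ln 2 / 2"
      using half_ln_sum_squares_approx[OF x zero_less_one] by simp
    from mult_left_mono[OF this b] b show ?thesis
      unfolding right_diff_distrib[symmetric] abs_mult by (simp only: abs_of_nonneg)
  qed
  moreover have "G x = g x + b * (ln (x\<^sup>2 + 1) / 2)" by (simp add: G_def b_def)
  moreover have "16 * ((1 - 2 * \<nu>) * (\<mu> - \<nu>) * pi / 2) / pi = 8 * (1 - 2 * \<nu>) * b"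
    by (simp add: b_def)
  moreover have "32 * b / pi = 16 * b / pi + 16 * b / pi" by (simp flip: add_divide_distrib)
  ultimately show ?thesis
    using P(2) T(2) g unfolding potential_error_def b_def[symmetric] by linarith
qed

lemma phi_decay: "\<exists>s0. \<forall>t. t \<noteq> 0 \<longrightarrow>
  \<bar>phi t\<bar> * \<bar>t\<bar> \<le> pi / 2 * decay_const \<mu> \<nu> * exp (- (2 * decay_rate \<mu> \<nu> * \<bar>ln (abs t) - s0\<bar>))"
proof -
  define p where "p s = 2 / pi * (exp s * phi (exp s))" for s
  define K where "K = 2 / pi * kappa \<mu> \<nu> g"
  define E where "E = potential_error \<mu> \<nu>"
  have K: "0 < K" using kappa_pos by (simp add: K_def)
  have p_dens: "p s = K * (dens (exp s) * exp s)" for s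
    by (simp add: p_def K_def phi_def)
  have m: "(log_mass phi has_real_derivative p s) (at s)" for s
    unfolding p_def by (rule log_mass_deriv[OF phi_even phi_cont])
  have A: "(max_potential phi has_real_derivative log_mass phi s) (at s)" for s
    using m DERIV_isCont by (intro max_potential_deriv) blast
  have G1: "\<bar>G (exp s) - max_potential phi s\<bar> \<le> E" for s
    using G_approx_max_potential[of "exp s"] by (simp add: E_def)
  have lower: "decay_lower \<mu> \<nu> * K * exp ((1 - 2 * \<nu>) * s - 2 * max_potential phi s) \<le> p s" for s
  proof -
    have "decay_lower \<mu> \<nu> * exp ((1 - 2 * \<nu>) * s - 2 * max_potential phi s)
        = \<nu> * exp (- (2 * E) + ((1 - 2 * \<nu>) * s - 2 * max_potential phi s))"
      unfolding decay_lower_def E_def[symmetric] exp_add by simp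
    also have "\<dots> \<le> \<nu> * exp ((1 - 2 * \<nu>) * ln (exp s) - 2 * G (exp s))"
      using nu G1[of s] by simp
    also have "\<dots> \<le> dens (exp s) * exp s" by (rule dens_lower) simp
    finally have "K * (decay_lower \<mu> \<nu> * exp ((1 - 2 * \<nu>) * s - 2 * max_potential phi s)) \<le> p s"
      unfolding p_dens using K by simp
    then show ?thesis by (simp add: mult_ac)
  qed
  \<comment> \<open>The slope of \<open>max_potential phi\<close> is at most
    \<open>\<mu> - \<nu>\<close>, so passing from \<open>G (exp s / 2)\<close> to the potential at
    \<open>s\<close> costs at most \<open>(\<mu> - \<nu>) * ln 2\<close>, besides the approximation
    error.\<close>
  have upper: "p s \<le> decay_upper \<mu> \<nu> * K * exp ((1 - 2 * \<nu>) * s - 2 * max_potential phi s)" for s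
  proof -
    have half: "exp s / 2 = exp (s - ln 2)" by (simp add: exp_diff)
    have "max_potential phi s - max_potential phi (s - ln 2) \<le> log_mass phi s * (s - (s - ln 2))"
      by (rule max_potential_increments) simp
    also have "\<dots> \<le> (\<mu> - \<nu>) * (s - (s - ln 2))" by (intro mult_right_mono log_mass_le) simp
    finally have "max_potential phi s - (\<mu> - \<nu>) * ln 2 - E \<le> G (exp s / 2)"
      using G1[of "s - ln 2"] unfolding half by simp
    then have "(1 - 2 * \<nu>) * s - G (exp s) - G (exp s / 2)
        \<le> (2 * E + (\<mu> - \<nu>) * ln 2) + ((1 - 2 * \<nu>) * s - 2 * max_potential phi s)"
      using G1[of s] by linarith
    then have "2 * exp ((1 - 2 * \<nu>) * ln (exp s) - G (exp s) - G (exp s / 2))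
        \<le> decay_upper \<mu> \<nu> * exp ((1 - 2 * \<nu>) * s - 2 * max_potential phi s)"
      unfolding decay_upper_def E_def[symmetric] by (simp flip: exp_add)
    moreover have "dens (exp s) * exp s \<le> 2 * exp ((1 - 2 * \<nu>) * ln (exp s) - G (exp s) - G (exp s / 2))"
      by (rule dens_upper) simp
    ultimately have "p s \<le> K * (decay_upper \<mu> \<nu> * exp ((1 - 2 * \<nu>) * s - 2 * max_potential phi s))"
      unfolding p_dens using K by (intro mult_left_mono) auto
    then show ?thesis by (simp add: mult_ac)
  qed
  have bound: "p s \<le> (1 - 2 * \<nu>) * (\<mu> - \<nu>)" for s
    using phi_bound[of "exp s"] by (simp add: p_def field_simps)
  \<comment> \<open>The comparison lemma is applied with \<open>a = 1 - 2 * \<nu>\<close> and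
    \<open>b = \<mu> - \<nu>\<close>; its condition \<open>a < 2 * b\<close> amounts to
    \<open>1/2 < \<mu>\<close>.\<close>
  have "\<exists>s0. \<forall>s. p s \<le> decay_upper \<mu> \<nu> * ((1 - 2 * \<nu>) * (\<mu> - \<nu>)) / decay_lower \<mu> \<nu>
      * exp (2 * decay_rate \<mu> \<nu>) * exp (- (2 * decay_rate \<mu> \<nu> * \<bar>s - s0\<bar>))"
    unfolding decay_rate_def
    by (rule liouville_comparison_decay[OF m A log_mass_at_bot log_mass_at_top[OF phi_mass] lower upper bound])
       (use K mu nu in \<open>auto simp: decay_lower_def decay_upper_def\<close>)
  then obtain s0 where s0: "\<And>s. p s \<le> decay_const \<mu> \<nu> * exp (- (2 * decay_rate \<mu> \<nu> * \<bar>s - s0\<bar>))"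
    unfolding decay_const_def by blast
  have "\<bar>phi t\<bar> * \<bar>t\<bar> \<le> pi / 2 * decay_const \<mu> \<nu> * exp (- (2 * decay_rate \<mu> \<nu> * \<bar>ln (abs t) - s0\<bar>))"
    if "t \<noteq> 0" for t
  proof -
    have "\<bar>phi t\<bar> * \<bar>t\<bar> = pi / 2 * p (ln (abs t))"
      using that nonneg[of t] by (simp add: p_def phi_def dens_abs)
    also have "\<dots> \<le> pi / 2 * (decay_const \<mu> \<nu> * exp (- (2 * decay_rate \<mu> \<nu> * \<bar>ln (abs t) - s0\<bar>)))"
      by (intro mult_left_mono s0) simp
    finally show ?thesis by (simp add: mult.assoc)
  qed
  then show ?thesis by blast
qed

lemma G_approx: "\<exists>x0>0. \<forall>x. \<bar>G x - (\<mu> - \<nu>) / 2 * ln (x\<^sup>2 + x0\<^sup>2)\<bar> \<le> profile_bound \<mu> \<nu>"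
proof -
  define b where "b = \<mu> - \<nu>"
  define I where "I = 16 * (pi / 2 * decay_const \<mu> \<nu>) / (2 * decay_rate \<mu> \<nu>)\<^sup>2"
  have b: "0 \<le> b" using mu nu by (simp add: b_def)
  obtain s0 where s0: "\<And>t. t \<noteq> 0 \<Longrightarrow>
      \<bar>phi t\<bar> * \<bar>t\<bar> \<le> pi / 2 * decay_const \<mu> \<nu> * exp (- (2 * decay_rate \<mu> \<nu> * \<bar>ln (abs t) - s0\<bar>))"
    using phi_decay by blast
  have "0 < 2 * decay_rate \<mu> \<nu>" using decay_rate_positive by simp
  from log_decay_integrable(3)[OF measurable_density this s0]
  have "(LBINT t. \<bar>phi t * (ln (abs t) - s0)\<bar>) \<le> I" by (simp add: I_def)
  note approx = max_potential_approx[OF phi_mass this, folded b_def]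
  \<comment> \<open>This makes \<open>ln x0\<close> the centre of the mass, so that
    \<open>b * max (ln x) s0\<close> is \<open>b / 2 * ln (x\<^sup>2 + x0\<^sup>2)\<close> up to a
    bounded error.\<close>
  define x0 where "x0 = exp s0"
  have x0: "0 < x0" "ln x0 = s0" by (simp_all add: x0_def)
  let ?D = "\<lambda>x. \<bar>G x - b / 2 * ln (x\<^sup>2 + x0\<^sup>2)\<bar>"
  have pos: "?D x \<le> profile_bound \<mu> \<nu>" if x: "0 < x" for x
  proof -
    have "\<bar>b * (ln (x\<^sup>2 + x0\<^sup>2) / 2) - b * max (ln x) s0\<bar> \<le> b * (ln 2 / 2)"
      using mult_left_mono[OF half_ln_sum_squares_approx[OF x x0(1)] b] b
      unfolding x0(2) right_diff_distrib[symmetric] abs_mult by (simp only: abs_of_nonneg)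
    then have "\<bar>b / 2 * ln (x\<^sup>2 + x0\<^sup>2) - b * max (ln x) s0\<bar> \<le> b * (ln 2 / 2)" by simp
    then show ?thesis
      using G_approx_max_potential[OF x] approx[of "ln x"]
      unfolding profile_bound_def I_def[symmetric] b_def[symmetric] by linarith
  qed
  \<comment> \<open>The potential estimates are made at \<open>ln x\<close> for
    \<open>x > 0\<close>; continuity carries the bound to the origin, and evenness to negative
    \<open>x\<close>.\<close>
  have zero: "?D 0 \<le> profile_bound \<mu> \<nu>"
  proof (rule tendsto_upperbound)
    have "0 < x\<^sup>2 + x0\<^sup>2" for x using x0 by (simp add: add_nonneg_pos)
    then have "continuous_on UNIV ?D"
      by (intro continuous_intros G_cont) (auto simp: less_imp_neq[symmetric])
    then have "(?D \<longlongrightarrow> ?D 0) (at 0 within UNIV)"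
      unfolding continuous_on_def by (rule bspec) simp
    then show "(?D \<longlongrightarrow> ?D 0) (at_right 0)"
      by (rule tendsto_within_subset) simp
    show "\<forall>\<^sub>F x in at_right 0. ?D x \<le> profile_bound \<mu> \<nu>"
      using eventually_at_right_less[of "0 :: real"] by eventually_elim (rule pos)
  qed simp
  have "?D x \<le> profile_bound \<mu> \<nu>" for x
  proof -
    have "G \<bar>x\<bar> = G x" by (simp add: G_def abs_if even)
    then have "?D x = ?D \<bar>x\<bar>" by simp
    then show ?thesis using pos[of "\<bar>x\<bar>"] zero by (cases "x = 0") auto
  qed
  then show ?thesis using x0(1) unfolding b_def by blast
qed

end

theorem theorem3p1:
  fixes \<mu> \<nu> :: real
  assumes "1/2 < \<mu>" and "\<mu> \<le> 2" and "0 < \<nu>" and "\<nu> < 1/2"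
  shows "\<exists>c::real. \<forall>g :: real \<Rightarrow> real.
           continuous_on UNIV g \<and> bounded (range g) \<and> solves_312 \<mu> \<nu> g \<and>
           (\<forall>x. g (-x) + (\<mu> - \<nu>)/2 * ln ((-x)\<^sup>2 + 1) = g x + (\<mu> - \<nu>)/2 * ln (x\<^sup>2 + 1)) \<and>
           mono_on {0..} (\<lambda>x. g x + (\<mu> - \<nu>)/2 * ln (x\<^sup>2 + 1))
           \<longrightarrow> (\<exists>x0>0. \<forall>x. \<bar>g x + (\<mu> - \<nu>)/2 * ln (x\<^sup>2 + 1) - (\<mu> - \<nu>)/2 * ln (x\<^sup>2 + x0\<^sup>2)\<bar> \<le> c)"
\<comment> \<open>\<open>profile_bound\<close> contains no trace of \<open>g\<close>, so it can be
  fixed before \<open>g\<close> is introduced.\<close>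
proof (rule exI[of _ "profile_bound \<mu> \<nu>"], intro allI impI, elim conjE)
  fix g :: "real \<Rightarrow> real"
  assume *: "continuous_on UNIV g" "bounded (range g)" "solves_312 \<mu> \<nu> g"
    "\<forall>x. g (-x) + (\<mu> - \<nu>)/2 * ln ((-x)\<^sup>2 + 1) = g x + (\<mu> - \<nu>)/2 * ln (x\<^sup>2 + 1)"
    "mono_on {0..} (\<lambda>x. g x + (\<mu> - \<nu>)/2 * ln (x\<^sup>2 + 1))"
  then interpret even_solution \<mu> \<nu> g
    using assms by unfold_locales auto
  show "\<exists>x0>0. \<forall>x. \<bar>g x + (\<mu> - \<nu>)/2 * ln (x\<^sup>2 + 1) - (\<mu> - \<nu>)/2 * ln (x\<^sup>2 + x0\<^sup>2)\<bar> \<le> profile_bound \<mu> \<nu>"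
    using G_approx unfolding G_def .
qed

end
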